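(* The functors $\mathsf{Spec}:(\text{mv-algebras})^{op}\to(\text{mv-spaces})$ and $\Gamma:(\text{mv-spaces})^{op}\to(\text{mv-algebras})$ establish an equivalence between the dual of the category of hyperarchimedean mv-algebras and the category of mv-spaces $(X,E)$ which are global Hausdorff sheaves of simple mv-algebras over Stone spaces.
   Context: An mv-algebra is a set $A$ with a binary operation $\oplus$, a unary operation $\neg$ and a constant $0$ such that $(A,\oplus,0)$ is a commutative monoid, $\neg\neg x = x$, $x\oplus\neg 0=\neg 0$ and $\neg(\neg x\oplus y)\oplus y=\neg(\neg y\oplus x)\oplus x$. Morphisms preserve $\oplus,\neg,0$. Derived: $1=\neg 0$, $x\ominus y=\neg(\neg x\oplus y)$, $d(x,y)=(x\ominus y)\oplus(y\ominus x)$, $nx=x\oplus\dots\oplus x$ ($n$ times); $x\le y \iff x\ominus y=0$ is a lattice order. An ideal is a subset containing $0$, downward closed and closed under $\oplus$; $A/I$ is the quotient by $x\sim y\iff d(x,y)\in I$. An ideal $P$ is prime if $1\notin P$ and for all $x,y$, $x\ominus y\in P$ or $y\ominus x\in P$. An mv-chain is a nontrivial ($1\ne0$) mv-algebra with total order. An mv-algebra is simple if it is nontrivial and $\{0\}$ is its only proper ideal (simple mv-algebras are mv-chains). $A$ is hyperarchimedean if for every $a\in A$ there is an integer $n\ge1$ with $na=(n+1)a$. An mv-space $(X,E)$ is a topological space $X$ with a sheaf of mv-chains on $X$: a local homeomorphism $E\to X$ whose fibers $E_x$ are mv-chains, such that for each open $U\subset X$ the set $\Gamma(U,E)$ of continuous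 sections over $U$ is a subalgebra of $\prod_{x\in U}E_x$. A morphism $(f,\varphi):(X,E)\to(Y,F)$ is a continuous $f:X\to Y$ together with mv-algebra morphisms $\varphi_x:F_{f(x)}\to E_x$, $x\in X$, such that for every open $V\subset Y$ and $s\in\Gamma(V,F)$, the function $x\mapsto\varphi_x(s(f(x)))$ is in $\Gamma(f^{-1}V,E)$. The sheaf is global if each $e\in E$ is a value of some global section; it is Hausdorff if $E$ (and hence $X$) is Hausdorff. A Stone space is a compact Hausdorff space with an open base of clopen sets. Both categories in the equivalence are full subcategories. $\mathsf{Spec}(A)=(Z_A,E_A)$: $Z_A$ is the set of prime ideals with open base $W_a=\{P:a\in P\}$, $a\in A$; $E_A$ is the disjoint union of the $A/P$ with open base the images $\widehat a(W_b)$, $a,b\in A$, where $\widehat a(P)=[a]_P$. A morphism $\psi:A\to B$ is sent to $P\mapsto\psi^{-1}(P)$ together with the induced maps $A/\psi^{-1}(P)\to B/P$. $\Gamma(X,E)$ is the mv-algebra of global sections, and $\Gamma(f,\varphi)$ sends $s\in\Gamma(Y,F)$ to $x\mapsto\varphi_x(s(f(x)))$. *)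

theory Defs
  imports "HOL-Analysis.Analysis"
begin

section \<open>MV-algebras\<close>

record 'a mv =
  carrier :: "'a set"
  mplus :: "'a \<Rightarrow> 'a \<Rightarrow> 'a" (infixl \<open>\<oplus>\<index>\<close> 65)
  mneg :: "'a \<Rightarrow> 'a"
  mzero :: 'a

locale mv_algebra =
  fixes A :: "'a mv" (structure)
  assumes plus_closed: "\<lbrakk>x \<in> carrier A; y \<in> carrier A\<rbrakk> \<Longrightarrow> x \<oplus> y \<in> carrier A"
    and neg_closed: "x \<in> carrier A \<Longrightarrow> mneg A x \<in> carrier A"
    and zero_closed: "mzero A \<in> carrier A"
    and plus_assoc: "\<lbrakk>x \<in> carrier A; y \<in> carrier A; z \<in> carrier A\<rbrakk> \<Longrightarrow> (x \<oplus> y) \<oplus> z = x \<oplus> (y \<oplus> z)"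
    and plus_comm: "\<lbrakk>x \<in> carrier A; y \<in> carrier A\<rbrakk> \<Longrightarrow> x \<oplus> y = y \<oplus> x"
    and plus_zero: "x \<in> carrier A \<Longrightarrow> x \<oplus> mzero A = x"
    and neg_neg: "x \<in> carrier A \<Longrightarrow> mneg A (mneg A x) = x"
    and plus_neg_zero: "x \<in> carrier A \<Longrightarrow> x \<oplus> mneg A (mzero A) = mneg A (mzero A)"
    and lukasiewicz: "\<lbrakk>x \<in> carrier A; y \<in> carrier A\<rbrakk> \<Longrightarrow>
      mneg A (mneg A x \<oplus> y) \<oplus> y = mneg A (mneg A y \<oplus> x) \<oplus> x"

definition mone :: "'a mv \<Rightarrow> 'a" where
  "mone A = mneg A (mzero A)"

definition mminus :: "'a mv \<Rightarrow> 'a \<Rightarrow> 'a \<Rightarrow> 'a" where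
  "mminus A x y = mneg A (mneg A x \<oplus>\<^bsub>A\<^esub> y)"

definition mdist :: "'a mv \<Rightarrow> 'a \<Rightarrow> 'a \<Rightarrow> 'a" where
  "mdist A x y = mminus A x y \<oplus>\<^bsub>A\<^esub> mminus A y x"

primrec mtimes :: "'a mv \<Rightarrow> nat \<Rightarrow> 'a \<Rightarrow> 'a" where
  "mtimes A 0 x = mzero A"
| "mtimes A (Suc n) x = x \<oplus>\<^bsub>A\<^esub> mtimes A n x"

definition mle :: "'a mv \<Rightarrow> 'a \<Rightarrow> 'a \<Rightarrow> bool" where
  "mle A x y \<longleftrightarrow> mminus A x y = mzero A"

definition mv_ideal :: "'a mv \<Rightarrow> 'a set \<Rightarrow> bool" where
  "mv_ideal A I \<longleftrightarrow> I \<subseteq> carrier A \<and> mzero A \<in> I \<and>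
     (\<forall>x\<in>carrier A. \<forall>y\<in>I. mle A x y \<longrightarrow> x \<in> I) \<and>
     (\<forall>x\<in>I. \<forall>y\<in>I. x \<oplus>\<^bsub>A\<^esub> y \<in> I)"

definition mv_prime :: "'a mv \<Rightarrow> 'a set \<Rightarrow> bool" where
  "mv_prime A P \<longleftrightarrow> mv_ideal A P \<and> mone A \<notin> P \<and>
     (\<forall>x\<in>carrier A. \<forall>y\<in>carrier A. mminus A x y \<in> P \<or> mminus A y x \<in> P)"

definition mv_nontrivial :: "'a mv \<Rightarrow> bool" where
  "mv_nontrivial A \<longleftrightarrow> mone A \<noteq> mzero A"

definition mv_chain :: "'a mv \<Rightarrow> bool" where
  "mv_chain A \<longleftrightarrow> mv_algebra A \<and> mv_nontrivial A \<and>
     (\<forall>x\<in>carrier A. \<forall>y\<in>carrier A. mle A x y \<or> mle A y x)"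

definition mv_simple :: "'a mv \<Rightarrow> bool" where
  "mv_simple A \<longleftrightarrow> mv_algebra A \<and> mv_nontrivial A \<and>
     (\<forall>I. mv_ideal A I \<and> I \<noteq> carrier A \<longrightarrow> I = {mzero A})"

definition hyperarchimedean :: "'a mv \<Rightarrow> bool" where
  "hyperarchimedean A \<longleftrightarrow> mv_algebra A \<and>
     (\<forall>a\<in>carrier A. \<exists>n\<ge>1. mtimes A n a = mtimes A (n + 1) a)"

text \<open>In both categories the maps that make up a morphism are extensional on their domains, so
  that HOL equality of morphisms with a given domain is equality of maps.\<close>

definition mv_hom :: "'a mv \<Rightarrow> 'b mv \<Rightarrow> ('a \<Rightarrow> 'b) set" where
  "mv_hom A B = {h \<in> carrier A \<rightarrow>\<^sub>E carrier B.
     (\<forall>x\<in>carrier A. \<forall>y\<in>carrier A. h (x \<oplus>\<^bsub>A\<^esub> y) = h x \<oplus>\<^bsub>B\<^esub> h y) \<and>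
     (\<forall>x\<in>carrier A. h (mneg A x) = mneg B (h x)) \<and>
     h (mzero A) = mzero B}"

definition mv_id :: "'a mv \<Rightarrow> 'a \<Rightarrow> 'a" where
  "mv_id A = (\<lambda>x\<in>carrier A. x)"

definition mv_comp :: "'a mv \<Rightarrow> ('b \<Rightarrow> 'c) \<Rightarrow> ('a \<Rightarrow> 'b) \<Rightarrow> 'a \<Rightarrow> 'c" where
  "mv_comp A k h = compose (carrier A) k h"

definition mv_iso :: "'a mv \<Rightarrow> 'b mv \<Rightarrow> ('a \<Rightarrow> 'b) \<Rightarrow> bool" where
  "mv_iso A B h \<longleftrightarrow> h \<in> mv_hom A B \<and>
     (\<exists>k\<in>mv_hom B A. mv_comp A k h = mv_id A \<and> mv_comp B h k = mv_id B)"

definition mv_subalgebra :: "'a set \<Rightarrow> 'a mv \<Rightarrow> bool" where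
  "mv_subalgebra S A \<longleftrightarrow> S \<subseteq> carrier A \<and> mzero A \<in> S \<and>
     (\<forall>x\<in>S. mneg A x \<in> S) \<and> (\<forall>x\<in>S. \<forall>y\<in>S. x \<oplus>\<^bsub>A\<^esub> y \<in> S)"

definition mv_prod :: "'i set \<Rightarrow> ('i \<Rightarrow> 'a mv) \<Rightarrow> ('i \<Rightarrow> 'a) mv" where
  "mv_prod U F = \<lparr>carrier = PiE U (\<lambda>i. carrier (F i)),
     mplus = (\<lambda>s t. \<lambda>i\<in>U. s i \<oplus>\<^bsub>F i\<^esub> t i),
     mneg = (\<lambda>s. \<lambda>i\<in>U. mneg (F i) (s i)),
     mzero = (\<lambda>i\<in>U. mzero (F i))\<rparr>"

definition mv_cong :: "'a mv \<Rightarrow> 'a set \<Rightarrow> ('a \<times> 'a) set" where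
  "mv_cong A I = {(x, y). x \<in> carrier A \<and> y \<in> carrier A \<and> mdist A x y \<in> I}"

definition mv_quot :: "'a mv \<Rightarrow> 'a set \<Rightarrow> 'a set mv" where
  "mv_quot A I = \<lparr>carrier = carrier A // mv_cong A I,
     mplus = (\<lambda>C D. \<Union>x\<in>C. \<Union>y\<in>D. mv_cong A I `` {x \<oplus>\<^bsub>A\<^esub> y}),
     mneg = (\<lambda>C. \<Union>x\<in>C. mv_cong A I `` {mneg A x}),
     mzero = mv_cong A I `` {mzero A}\<rparr>"


section \<open>MV-spaces\<close>

text \<open>The algebra \<open>stalk X x\<close> lives on the fibre of the projection over \<open>x\<close>.\<close>

record ('x, 'e) mv_sheaf =
  base_space :: "'x topology"
  total_space :: "'e topology"
  proj :: "'e \<Rightarrow> 'x"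
  stalk :: "'x \<Rightarrow> 'e mv"

abbreviation pts :: "('x, 'e) mv_sheaf \<Rightarrow> 'x set" where
  "pts X \<equiv> topspace (base_space X)"

definition local_homeomorphism :: "'e topology \<Rightarrow> 'x topology \<Rightarrow> ('e \<Rightarrow> 'x) \<Rightarrow> bool" where
  "local_homeomorphism E X p \<longleftrightarrow>
     (\<forall>e\<in>topspace E. \<exists>U. openin E U \<and> e \<in> U \<and> openin X (p ` U) \<and>
        homeomorphic_map (subtopology E U) (subtopology X (p ` U)) p)"

definition sections :: "('x, 'e) mv_sheaf \<Rightarrow> 'x set \<Rightarrow> ('x \<Rightarrow> 'e) set" where
  "sections X U = {s \<in> extensional U.
     continuous_map (subtopology (base_space X) U) (total_space X) s \<and> (\<forall>x\<in>U. proj X (s x) = x)}"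

definition mv_space :: "('x, 'e) mv_sheaf \<Rightarrow> bool" where
  "mv_space X \<longleftrightarrow>
     local_homeomorphism (total_space X) (base_space X) (proj X) \<and>
     (\<forall>x\<in>pts X. carrier (stalk X x) = {e \<in> topspace (total_space X). proj X e = x} \<and>
        mv_chain (stalk X x)) \<and>
     (\<forall>U. openin (base_space X) U \<longrightarrow> mv_subalgebra (sections X U) (mv_prod U (stalk X)))"

text \<open>A morphism \<open>X \<rightarrow> Y\<close> is a pair \<open>(f, \<phi>)\<close> with \<open>\<phi> x\<close> a map from the stalk of \<open>Y\<close> at \<open>f x\<close>
  to the stalk of \<open>X\<close> at \<open>x\<close>.\<close>

type_synonym ('x, 'e, 'y, 'f) mv_space_map = "('x \<Rightarrow> 'y) \<times> ('x \<Rightarrow> 'f \<Rightarrow> 'e)"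

definition mvs_hom ::
  "('x, 'e) mv_sheaf \<Rightarrow> ('y, 'f) mv_sheaf \<Rightarrow> ('x, 'e, 'y, 'f) mv_space_map set" where
  "mvs_hom X Y = {(f, \<phi>).
     f \<in> extensional (pts X) \<and> continuous_map (base_space X) (base_space Y) f \<and>
     \<phi> \<in> extensional (pts X) \<and> (\<forall>x\<in>pts X. \<phi> x \<in> mv_hom (stalk Y (f x)) (stalk X x)) \<and>
     (\<forall>V s. openin (base_space Y) V \<and> s \<in> sections Y V \<longrightarrow>
        (\<lambda>x\<in>{x \<in> pts X. f x \<in> V}. \<phi> x (s (f x))) \<in> sections X {x \<in> pts X. f x \<in> V})}"

definition mvs_id :: "('x, 'e) mv_sheaf \<Rightarrow> ('x, 'e, 'x, 'e) mv_space_map" where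
  "mvs_id X = ((\<lambda>x\<in>pts X. x), (\<lambda>x\<in>pts X. mv_id (stalk X x)))"

text \<open>The composite \<open>(g, \<gamma>) \<circ> (f, \<phi>)\<close> of \<open>(f, \<phi>) : X \<rightarrow> Y\<close> and \<open>(g, \<gamma>) : Y \<rightarrow> Z\<close>.\<close>

definition mvs_comp :: "('x, 'e) mv_sheaf \<Rightarrow> ('z, 'g) mv_sheaf \<Rightarrow>
    ('y, 'f, 'z, 'g) mv_space_map \<Rightarrow> ('x, 'e, 'y, 'f) mv_space_map \<Rightarrow>
    ('x, 'e, 'z, 'g) mv_space_map" where
  "mvs_comp X Z = (\<lambda>(g, \<gamma>) (f, \<phi>).
     (compose (pts X) g f,
      \<lambda>x\<in>pts X. mv_comp (stalk Z (g (f x))) (\<phi> x) (\<gamma> (f x))))"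

definition mvs_iso ::
  "('x, 'e) mv_sheaf \<Rightarrow> ('y, 'f) mv_sheaf \<Rightarrow> ('x, 'e, 'y, 'f) mv_space_map \<Rightarrow> bool" where
  "mvs_iso X Y m \<longleftrightarrow> m \<in> mvs_hom X Y \<and>
     (\<exists>n\<in>mvs_hom Y X. mvs_comp X X n m = mvs_id X \<and> mvs_comp Y Y m n = mvs_id Y)"

definition stone_space :: "'x topology \<Rightarrow> bool" where
  "stone_space X \<longleftrightarrow> compact_space X \<and> Hausdorff_space X \<and>
     openin X = arbitrary union_of (\<lambda>U. openin X U \<and> closedin X U)"

definition global_sheaf :: "('x, 'e) mv_sheaf \<Rightarrow> bool" where
  "global_sheaf X \<longleftrightarrow>
     (\<forall>e\<in>topspace (total_space X). \<exists>s\<in>sections X (pts X). \<exists>x\<in>pts X. s x = e)"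

definition hausdorff_sheaf :: "('x, 'e) mv_sheaf \<Rightarrow> bool" where
  "hausdorff_sheaf X \<longleftrightarrow> Hausdorff_space (total_space X)"

definition stone_simple_space :: "('x, 'e) mv_sheaf \<Rightarrow> bool" where
  "stone_simple_space X \<longleftrightarrow> mv_space X \<and> global_sheaf X \<and> hausdorff_sheaf X \<and>
     (\<forall>x\<in>pts X. mv_simple (stalk X x)) \<and> stone_space (base_space X)"


section \<open>The functor Spec\<close>

definition primes :: "'a mv \<Rightarrow> 'a set set" where
  "primes A = {P. mv_prime A P}"

definition W :: "'a mv \<Rightarrow> 'a \<Rightarrow> 'a set set" where
  "W A a = {P \<in> primes A. a \<in> P}"

text \<open>A point of the disjoint union of the \<open>A/P\<close> is a pair \<open>(P, C)\<close> with \<open>C\<close> a class in \<open>A/P\<close>;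
  \<open>tagged_quot A P\<close> is the copy \<open>{P} \<times> A/P\<close> of \<open>A/P\<close>.\<close>

definition hat :: "'a mv \<Rightarrow> 'a \<Rightarrow> 'a set \<Rightarrow> 'a set \<times> 'a set" where
  "hat A a = (\<lambda>P\<in>primes A. (P, mv_cong A P `` {a}))"

definition tagged_quot :: "'a mv \<Rightarrow> 'a set \<Rightarrow> ('a set \<times> 'a set) mv" where
  "tagged_quot A P = \<lparr>carrier = {P} \<times> carrier (mv_quot A P),
     mplus = (\<lambda>u v. (P, snd u \<oplus>\<^bsub>mv_quot A P\<^esub> snd v)),
     mneg = (\<lambda>u. (P, mneg (mv_quot A P) (snd u))),
     mzero = (P, mzero (mv_quot A P))\<rparr>"

definition Spec :: "'a mv \<Rightarrow> ('a set, 'a set \<times> 'a set) mv_sheaf" where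
  "Spec A = \<lparr>base_space = topology (arbitrary union_of (\<lambda>U. \<exists>a\<in>carrier A. U = W A a)),
     total_space = topology (arbitrary union_of
       (\<lambda>U. \<exists>a\<in>carrier A. \<exists>b\<in>carrier A. U = hat A a ` W A b)),
     proj = fst,
     stalk = tagged_quot A\<rparr>"

definition Spec_map :: "'a mv \<Rightarrow> 'b mv \<Rightarrow> ('a \<Rightarrow> 'b) \<Rightarrow>
    ('b set, 'b set \<times> 'b set, 'a set, 'a set \<times> 'a set) mv_space_map" where
  "Spec_map A B \<psi> = (let f = (\<lambda>P. {a \<in> carrier A. \<psi> a \<in> P}) in
     (\<lambda>P\<in>primes B. f P,
      \<lambda>P\<in>primes B. \<lambda>u\<in>carrier (tagged_quot A (f P)).
        (P, \<Union>a\<in>snd u. mv_cong B P `` {\<psi> a})))"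


section \<open>The functor \<open>\<Gamma>\<close>\<close>

definition Gam :: "('x, 'e) mv_sheaf \<Rightarrow> ('x \<Rightarrow> 'e) mv" where
  "Gam X = (mv_prod (pts X) (stalk X))\<lparr>carrier := sections X (pts X)\<rparr>"

definition Gam_map :: "('x, 'e) mv_sheaf \<Rightarrow> ('y, 'f) mv_sheaf \<Rightarrow>
    ('x, 'e, 'y, 'f) mv_space_map \<Rightarrow> ('y \<Rightarrow> 'f) \<Rightarrow> ('x \<Rightarrow> 'e)" where
  "Gam_map X Y = (\<lambda>(f, \<phi>). \<lambda>s\<in>carrier (Gam Y). \<lambda>x\<in>pts X. \<phi> x (s (f x)))"


section \<open>The canonical comparison morphisms\<close>

definition unit_mv :: "'a mv \<Rightarrow> 'a \<Rightarrow> ('a set \<Rightarrow> 'a set \<times> 'a set)" where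
  "unit_mv A = (\<lambda>a\<in>carrier A. hat A a)"

text \<open>\<open>X \<rightarrow> Spec (\<Gamma> X)\<close> sends \<open>x\<close> to the ideal of global sections vanishing at \<open>x\<close>; on stalks it
  is evaluation at \<open>x\<close>, the class of \<open>s\<close> being sent to \<open>s x\<close>.\<close>

definition vanishing :: "('x, 'e) mv_sheaf \<Rightarrow> 'x \<Rightarrow> ('x \<Rightarrow> 'e) set" where
  "vanishing X x = {s \<in> carrier (Gam X). s x = mzero (stalk X x)}"

definition unit_mvs :: "('x, 'e) mv_sheaf \<Rightarrow>
    ('x, 'e, ('x \<Rightarrow> 'e) set, ('x \<Rightarrow> 'e) set \<times> ('x \<Rightarrow> 'e) set) mv_space_map" where
  "unit_mvs X =
     (\<lambda>x\<in>pts X. vanishing X x,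
      \<lambda>x\<in>pts X. \<lambda>u\<in>carrier (tagged_quot (Gam X) (vanishing X x)).
        the_elem ((\<lambda>s. s x) ` snd u))"

end

theory Submission
  imports Defs
begin

text \<open>
  The proof rests on one observation about prime ideals. Suppose \<open>n a = (n + 1) a\<close> and put \<open>e = n a\<close>.
  Adding \<open>a\<close> to \<open>e\<close> has no effect, so \<open>a\<close> and \<open>\<not> e\<close> have meet \<open>0\<close>, and a prime ideal contains exactly one
  of them (\<open>hyperarchimedean_boolean\<close>). Over a hyperarchimedean algebra \<open>A\<close> this has four consequences:
  the basic open sets \<open>W a\<close> are clopen and so the spectrum is Hausdorff; there are no proper
  inclusions between primes; each \<open>A/P\<close>, being a hyperarchimedean chain, is simple; and \<open>e\<close> takes the
  values \<open>0\<close> and \<open>1\<close> on \<open>W a\<close> and its complement, which allows sections to be patched.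

  The other ingredient from algebra is prime separation (\<open>prime_separation\<close>): an element outside an
  ideal is left out by some prime above that ideal. It yields compactness of the spectrum
  (\<open>Spec_compact\<close>) and the injectivity of \<open>a \<mapsto> hat a\<close>.
  The topological ingredient is that two sections of a local homeomorphism agree on an open set
  (\<open>sections_agree_open\<close>); it shows that sections of the spectral sheaf are exactly the functions
  given locally by elements of \<open>A\<close> (\<open>sections_Spec\<close>). With compactness, such a section is
  given by finitely many elements, and these are patched to a single one, so that \<open>A\<close> is the algebra of
  global sections of its spectrum (\<open>unit_mv_iso\<close>).

  Conversely, let \<open>X\<close> be a global sheaf of simple algebras over a Stone space. At each point a value is \<open>0\<close>
  or has \<open>1\<close> as a multiple, so some multiple of it is stationary; compactness makes one multiple work at
  all points, and \<open>\<Gamma> X\<close> is hyperarchimedean (\<open>Gam_hyperarchimedean\<close>). The sections vanishing at a point form a prime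
  ideal. Clopen sets separate points, and by compactness every prime is of this form
  (\<open>vanishing_surj\<close>); so the points of \<open>X\<close> are those of the spectrum of \<open>\<Gamma> X\<close>, homeomorphically, and
  evaluation identifies the stalks (\<open>unit_mvs_iso\<close>). Naturality in \<open>X\<close> uses that homomorphisms from a
  simple algebra to a chain are injective.
\<close>

section \<open>Arithmetic in MV-algebras\<close>

context mv_algebra
begin

notation mzero ("\<zero>\<index>")
notation mone ("\<one>\<index>")

abbreviation neg ("\<sim> _" [90] 90) where "\<sim> x \<equiv> mneg A x"
abbreviation minus (infixl "\<ominus>" 65) where "x \<ominus> y \<equiv> mminus A x y"
abbreviation le (infix "\<preceq>" 50) where "x \<preceq> y \<equiv> mle A x y"

lemma one_closed: "\<one> \<in> carrier A"
  by (simp add: mone_def neg_closed zero_closed)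

lemma minus_closed: "\<lbrakk>x \<in> carrier A; y \<in> carrier A\<rbrakk> \<Longrightarrow> x \<ominus> y \<in> carrier A"
  by (simp add: mminus_def neg_closed plus_closed)

lemma dist_closed: "\<lbrakk>x \<in> carrier A; y \<in> carrier A\<rbrakk> \<Longrightarrow> mdist A x y \<in> carrier A"
  by (simp add: mdist_def minus_closed plus_closed)

lemma times_closed: "x \<in> carrier A \<Longrightarrow> mtimes A n x \<in> carrier A"
  by (induction n) (auto simp: zero_closed plus_closed)

lemmas closed = plus_closed neg_closed zero_closed one_closed minus_closed dist_closed times_closed

lemma zero_plus: "x \<in> carrier A \<Longrightarrow> \<zero> \<oplus> x = x"
  using plus_comm plus_zero zero_closed by metis

lemma plus_one: "x \<in> carrier A \<Longrightarrow> x \<oplus> \<one> = \<one>"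
  by (simp add: mone_def plus_neg_zero)

lemma neg_one: "\<sim> \<one> = \<zero>"
  by (simp add: mone_def neg_neg zero_closed)

lemma neg_plus: "x \<in> carrier A \<Longrightarrow> \<sim> x \<oplus> x = \<one>"
  using lukasiewicz[of x \<one>]
  by (simp add: closed plus_one neg_one zero_plus)

lemma plus_neg: "x \<in> carrier A \<Longrightarrow> x \<oplus> \<sim> x = \<one>"
  using neg_plus plus_comm neg_closed by metis

lemma minus_zero: "x \<in> carrier A \<Longrightarrow> x \<ominus> \<zero> = x"
  by (simp add: mminus_def plus_zero neg_closed neg_neg)

lemma minus_one: "x \<in> carrier A \<Longrightarrow> x \<ominus> \<one> = \<zero>"
  by (simp add: mminus_def plus_one neg_closed neg_one)

lemma minus_self: "x \<in> carrier A \<Longrightarrow> x \<ominus> x = \<zero>"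
  by (simp add: mminus_def neg_plus neg_one)

lemma le_iff: "\<lbrakk>x \<in> carrier A; y \<in> carrier A\<rbrakk> \<Longrightarrow> x \<preceq> y \<longleftrightarrow> \<sim> x \<oplus> y = \<one>"
  unfolding mle_def mminus_def mone_def by (metis closed(1,2,3) neg_neg)

lemma minus_minus: "\<lbrakk>x \<in> carrier A; y \<in> carrier A; z \<in> carrier A\<rbrakk> \<Longrightarrow> x \<ominus> y \<ominus> z = x \<ominus> (y \<oplus> z)"
  by (simp add: mminus_def neg_neg closed plus_assoc)

text \<open>Truncated subtraction is residual to addition; most inequalities below are read off from
  this equivalence.\<close>

lemma minus_le_iff:
  "\<lbrakk>x \<in> carrier A; y \<in> carrier A; z \<in> carrier A\<rbrakk> \<Longrightarrow> x \<ominus> y \<preceq> z \<longleftrightarrow> x \<preceq> y \<oplus> z"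
  by (simp add: mle_def minus_minus)

lemma minus_plus_commute:
  "\<lbrakk>x \<in> carrier A; y \<in> carrier A\<rbrakk> \<Longrightarrow> (x \<ominus> y) \<oplus> y = (y \<ominus> x) \<oplus> x"
  unfolding mminus_def by (rule lukasiewicz)

lemma le_refl: "x \<in> carrier A \<Longrightarrow> x \<preceq> x"
  by (simp add: mle_def minus_self)

lemma le_antisym: "\<lbrakk>x \<in> carrier A; y \<in> carrier A; x \<preceq> y; y \<preceq> x\<rbrakk> \<Longrightarrow> x = y"
  using minus_plus_commute[of x y] by (simp add: mle_def zero_plus)

lemma le_plus: "\<lbrakk>x \<in> carrier A; y \<in> carrier A\<rbrakk> \<Longrightarrow> x \<preceq> x \<oplus> y"
  by (simp add: le_iff closed flip: plus_assoc) (simp add: neg_plus plus_one closed plus_comm[of \<one>])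

lemma le_plus2: "\<lbrakk>x \<in> carrier A; y \<in> carrier A\<rbrakk> \<Longrightarrow> x \<preceq> y \<oplus> x"
  using le_plus plus_comm by simp

lemma le_decomp: "\<lbrakk>x \<in> carrier A; y \<in> carrier A; x \<preceq> y\<rbrakk> \<Longrightarrow> y = x \<oplus> (y \<ominus> x)"
  using minus_plus_commute[of x y] by (simp add: mle_def zero_plus plus_comm[of x] closed)

lemma le_trans:
  assumes "x \<in> carrier A" "y \<in> carrier A" "z \<in> carrier A" "x \<preceq> y" "y \<preceq> z"
  shows "x \<preceq> z"
proof -
  have "z = (x \<oplus> (y \<ominus> x)) \<oplus> (z \<ominus> y)" using assms le_decomp by simp
  also have "\<dots> = x \<oplus> ((y \<ominus> x) \<oplus> (z \<ominus> y))" using assms by (simp add: plus_assoc closed)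
  finally show ?thesis using assms le_plus[of x "(y \<ominus> x) \<oplus> (z \<ominus> y)"] by (simp add: closed)
qed

lemma plus_mono2:
  assumes "x \<in> carrier A" "y \<in> carrier A" "z \<in> carrier A" "x \<preceq> y"
  shows "z \<oplus> x \<preceq> z \<oplus> y"
proof -
  have "z \<oplus> y = (z \<oplus> x) \<oplus> (y \<ominus> x)" using assms le_decomp by (simp add: plus_assoc closed)
  then show ?thesis using assms by (simp add: le_plus closed)
qed

lemma plus_mono:
  assumes "x \<in> carrier A" "y \<in> carrier A" "z \<in> carrier A" "w \<in> carrier A" "x \<preceq> y" "z \<preceq> w"
  shows "x \<oplus> z \<preceq> y \<oplus> w"
proof (rule le_trans)
  show "x \<oplus> z \<preceq> x \<oplus> w" using assms plus_mono2 by simp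
  show "x \<oplus> w \<preceq> y \<oplus> w" using assms plus_mono2[of x y w] by (simp add: plus_comm)
qed (use assms in \<open>auto simp: closed\<close>)

lemma zero_le: "x \<in> carrier A \<Longrightarrow> \<zero> \<preceq> x"
  using le_plus[of \<zero> x] by (simp add: closed zero_plus)

lemma le_one: "x \<in> carrier A \<Longrightarrow> x \<preceq> \<one>"
  by (simp add: mle_def minus_one)

lemma minus_le: "\<lbrakk>x \<in> carrier A; y \<in> carrier A\<rbrakk> \<Longrightarrow> x \<ominus> y \<preceq> x"
  by (simp add: minus_le_iff closed le_plus2)

lemma le_plus_minus: "\<lbrakk>x \<in> carrier A; y \<in> carrier A\<rbrakk> \<Longrightarrow> x \<preceq> y \<oplus> (x \<ominus> y)"
  using minus_le_iff[of x y "x \<ominus> y"] by (simp add: closed le_refl)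

lemma minus_antimono:
  assumes "x \<in> carrier A" "y \<in> carrier A" "z \<in> carrier A" "y \<preceq> z"
  shows "x \<ominus> z \<preceq> x \<ominus> y"
proof -
  have "x \<preceq> y \<oplus> (x \<ominus> y)" "y \<oplus> (x \<ominus> y) \<preceq> z \<oplus> (x \<ominus> y)"
    using assms by (auto simp: le_plus_minus closed intro!: plus_mono le_refl)
  then have "x \<preceq> z \<oplus> (x \<ominus> y)"
    using assms le_trans[of x "y \<oplus> (x \<ominus> y)" "z \<oplus> (x \<ominus> y)"] by (simp add: closed)
  then show ?thesis using assms by (simp add: minus_le_iff closed)
qed

lemma le_zero_iff: "x \<in> carrier A \<Longrightarrow> x \<preceq> \<zero> \<longleftrightarrow> x = \<zero>"
  using le_antisym zero_le le_refl zero_closed by metis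

lemma neg_minus_neg: "\<lbrakk>x \<in> carrier A; y \<in> carrier A\<rbrakk> \<Longrightarrow> \<sim> x \<ominus> \<sim> y = y \<ominus> x"
  by (simp add: mminus_def neg_neg plus_comm closed)

lemma plus_left_commute:
  "\<lbrakk>x \<in> carrier A; y \<in> carrier A; z \<in> carrier A\<rbrakk> \<Longrightarrow> x \<oplus> (y \<oplus> z) = y \<oplus> (x \<oplus> z)"
  by (metis plus_assoc plus_comm)

lemmas plus_ac = plus_assoc plus_comm plus_left_commute

text \<open>This estimate and the next make the relation \<open>d(x, y) \<in> I\<close> transitive and compatible with addition.\<close>

lemma minus_triangle:
  assumes "x \<in> carrier A" "y \<in> carrier A" "z \<in> carrier A"
  shows "x \<ominus> z \<preceq> (x \<ominus> y) \<oplus> (y \<ominus> z)"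
proof -
  have "x \<preceq> y \<oplus> (x \<ominus> y)" using assms le_plus_minus by simp
  moreover have "y \<oplus> (x \<ominus> y) \<preceq> (z \<oplus> (y \<ominus> z)) \<oplus> (x \<ominus> y)"
    using assms by (intro plus_mono) (auto simp: closed le_plus_minus le_refl)
  ultimately have "x \<preceq> (z \<oplus> (y \<ominus> z)) \<oplus> (x \<ominus> y)"
    using assms le_trans[of x "y \<oplus> (x \<ominus> y)" "(z \<oplus> (y \<ominus> z)) \<oplus> (x \<ominus> y)"] by (simp add: closed)
  also have "\<dots> = z \<oplus> ((x \<ominus> y) \<oplus> (y \<ominus> z))" using assms by (simp add: closed plus_ac)
  finally show ?thesis using assms by (simp add: minus_le_iff closed)
qed

lemma plus_minus_plus_le:
  assumes "x \<in> carrier A" "y \<in> carrier A" "x' \<in> carrier A" "y' \<in> carrier A"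
  shows "(x \<oplus> y) \<ominus> (x' \<oplus> y') \<preceq> (x \<ominus> x') \<oplus> (y \<ominus> y')"
proof -
  have "x \<oplus> y \<preceq> (x' \<oplus> (x \<ominus> x')) \<oplus> (y' \<oplus> (y \<ominus> y'))"
    using assms by (intro plus_mono) (auto simp: closed le_plus_minus)
  also have "\<dots> = (x' \<oplus> y') \<oplus> ((x \<ominus> x') \<oplus> (y \<ominus> y'))" using assms by (simp add: closed plus_ac)
  finally show ?thesis using assms by (simp add: minus_le_iff closed)
qed

text \<open>The element \<open>x \<ominus> (x \<ominus> y)\<close> is the meet of \<open>x\<close> and \<open>y\<close>; its symmetry is the Lukasiewicz axiom read
  through negation.\<close>

lemma meet_commute:
  assumes "x \<in> carrier A" "y \<in> carrier A"
  shows "x \<ominus> (x \<ominus> y) = y \<ominus> (y \<ominus> x)"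
  using lukasiewicz[of "\<sim> x" "\<sim> y"] assms
  by (simp add: mminus_def neg_neg closed plus_comm)

lemma meet_le1: "\<lbrakk>x \<in> carrier A; y \<in> carrier A\<rbrakk> \<Longrightarrow> x \<ominus> (x \<ominus> y) \<preceq> x"
  by (simp add: minus_le closed)

lemma meet_le2: "\<lbrakk>x \<in> carrier A; y \<in> carrier A\<rbrakk> \<Longrightarrow> x \<ominus> (x \<ominus> y) \<preceq> y"
  by (simp add: minus_le closed meet_commute[of x y])

lemma meet_greatest:
  assumes "x \<in> carrier A" "y \<in> carrier A" "w \<in> carrier A" "w \<preceq> x" "w \<preceq> y"
  shows "w \<preceq> x \<ominus> (x \<ominus> y)"
proof -
  have "w = x \<ominus> (x \<ominus> w)"
    using assms meet_commute[of w x] by (simp add: mle_def minus_zero)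
  moreover have "x \<ominus> (x \<ominus> w) \<preceq> x \<ominus> (x \<ominus> y)"
    using assms by (intro minus_antimono) (auto simp: closed)
  ultimately show ?thesis by simp
qed

text \<open>Addition is cancellative as long as the sum is not truncated, that is, as long as the summand
  stays below the complement.\<close>

lemma plus_minus_cancel:
  assumes "z \<in> carrier A" "w \<in> carrier A" "w \<preceq> \<sim> z"
  shows "(z \<oplus> w) \<ominus> z = w"
proof -
  have "(z \<oplus> w) \<ominus> z = \<sim> z \<ominus> (\<sim> z \<ominus> w)"
    using assms by (simp add: mminus_def neg_neg closed plus_comm)
  also have "\<dots> = w \<ominus> (w \<ominus> \<sim> z)" using assms by (intro meet_commute) (auto simp: closed)
  also have "\<dots> = w" using assms by (simp add: mle_def minus_zero)
  finally show ?thesis .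
qed

text \<open>This says that the meet of \<open>u\<close> and \<open>v\<close> is \<open>\<zero>\<close>, in a form that needs no formula for the meet.\<close>

definition disj :: "'a \<Rightarrow> 'a \<Rightarrow> bool" where
  "disj u v \<longleftrightarrow> (\<forall>w\<in>carrier A. w \<preceq> u \<longrightarrow> w \<preceq> v \<longrightarrow> w = \<zero>)"

lemma disj_sym: "disj u v \<longleftrightarrow> disj v u"
  by (auto simp: disj_def)

lemma disj_zero: "disj \<zero> v"
  by (auto simp: disj_def le_zero_iff)

text \<open>A common lower bound \<open>w\<close> of \<open>x \<ominus> y\<close> and \<open>y \<ominus> x\<close> can be added to the meet \<open>z\<close> of \<open>x\<close> and \<open>y\<close>
  without leaving the lower bounds of \<open>x\<close> and \<open>y\<close>. Hence \<open>z \<oplus> w = z\<close>, and cancellation gives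
  \<open>w = \<zero>\<close>.\<close>

lemma disj_minus:
  assumes "x \<in> carrier A" "y \<in> carrier A"
  shows "disj (x \<ominus> y) (y \<ominus> x)"
  unfolding disj_def
proof (intro ballI impI)
  fix w assume w: "w \<in> carrier A" "w \<preceq> x \<ominus> y" "w \<preceq> y \<ominus> x"
  define z where "z = x \<ominus> (x \<ominus> y)"
  have z: "z \<in> carrier A" "z = y \<ominus> (y \<ominus> x)" using assms by (auto simp: z_def closed meet_commute)
  have sum: "z \<oplus> w \<preceq> v \<and> w \<preceq> \<sim> z"
    if "v \<in> carrier A" "u \<in> carrier A" "w \<preceq> v \<ominus> u" "z = v \<ominus> (v \<ominus> u)" for u v
  proof
    have "z \<oplus> (v \<ominus> u) = v"
      using that le_decomp[of "v \<ominus> u" v] minus_le[of v u] by (simp add: closed plus_comm)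
    then show "z \<oplus> w \<preceq> v" using that z(1) w plus_mono2[of w "v \<ominus> u" z] by (simp add: closed)
    have "v \<ominus> u \<preceq> \<sim> z"
      using le_plus2[of "v \<ominus> u" "\<sim> v"] that by (simp add: mminus_def[of A v "v \<ominus> u"] neg_neg closed)
    then show "w \<preceq> \<sim> z" using that z(1) w le_trans[of w "v \<ominus> u" "\<sim> z"] by (simp add: closed)
  qed
  have "z \<oplus> w \<preceq> z"
    using sum[of x y] sum[of y x] assms z w meet_greatest[of x y "z \<oplus> w"] by (auto simp: closed z_def)
  then have "z \<oplus> w = z" using z w by (intro le_antisym) (auto simp: closed le_plus)
  moreover have "(z \<oplus> w) \<ominus> z = w" using sum[of x y] assms z w plus_minus_cancel by (auto simp: z_def)
  ultimately show "w = \<zero>" using z(1) by (simp add: minus_self)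
qed

text \<open>Disjointness from \<open>v\<close> is preserved by sums: removing \<open>u\<close> from a common lower bound of \<open>u \<oplus> u'\<close> and \<open>v\<close>
  leaves a common lower bound of \<open>u'\<close> and \<open>v\<close>.\<close>

lemma disj_plus:
  assumes "u \<in> carrier A" "u' \<in> carrier A" "v \<in> carrier A" "disj u v" "disj u' v"
  shows "disj (u \<oplus> u') v"
  unfolding disj_def
proof (intro ballI impI)
  fix w assume w: "w \<in> carrier A" "w \<preceq> u \<oplus> u'" "w \<preceq> v"
  have "w \<ominus> u \<preceq> u'" using w assms by (simp add: minus_le_iff)
  moreover have "w \<ominus> u \<preceq> v" using w assms le_trans[OF _ _ _ minus_le w(3)] by (simp add: closed)
  ultimately have "w \<ominus> u = \<zero>" using assms w by (auto simp: disj_def closed)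
  then have "w \<preceq> u" by (simp add: mle_def)
  then show "w = \<zero>" using assms w by (auto simp: disj_def)
qed

lemma disj_times:
  assumes "u \<in> carrier A" "v \<in> carrier A" "disj u v"
  shows "disj (mtimes A n u) v"
  using assms by (induction n) (auto simp: disj_zero intro!: disj_plus simp: closed)

text \<open>If adding \<open>y\<close> does not increase \<open>x\<close>, then \<open>y\<close> lives where \<open>x\<close> is already \<open>\<one>\<close>.\<close>

lemma disj_absorbed:
  assumes "x \<in> carrier A" "y \<in> carrier A" "x \<oplus> y = x"
  shows "disj y (\<sim> x)"
  unfolding disj_def
proof (intro ballI impI)
  fix w assume w: "w \<in> carrier A" "w \<preceq> y" "w \<preceq> \<sim> x"
  have "x \<oplus> w \<preceq> x" using plus_mono2[of w y x] assms w by simp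
  then have "x \<oplus> w = x" using assms w by (intro le_antisym) (auto simp: closed le_plus)
  then show "w = \<zero>" using plus_minus_cancel[of x w] assms w by (simp add: minus_self)
qed

lemma disj_meet: "\<lbrakk>x \<in> carrier A; y \<in> carrier A; disj x y\<rbrakk> \<Longrightarrow> x \<preceq> x \<ominus> y"
  using meet_le1[of x y] meet_le2[of x y] by (simp add: disj_def mle_def[of A x] closed)

lemma times_add:
  "x \<in> carrier A \<Longrightarrow> mtimes A (m + n) x = mtimes A m x \<oplus> mtimes A n x"
  by (induction m) (auto simp: zero_plus closed plus_assoc)

lemma times_stable:
  assumes "x \<in> carrier A" "mtimes A n x = mtimes A (Suc n) x" "n \<le> m"
  shows "mtimes A m x = mtimes A n x"
  using assms(3)
proof (induction rule: dec_induct)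
  case (step k)
  then show ?case using assms(2)[symmetric] by simp
qed simp

lemma dist_zero_iff: 
  assumes "x \<in> carrier A" "y \<in> carrier A"
  shows "mdist A x y = \<zero> \<longleftrightarrow> x = y"
proof
  assume 0: "mdist A x y = \<zero>"
  have "x \<ominus> y \<preceq> \<zero>" "y \<ominus> x \<preceq> \<zero>"
    using assms le_plus[of "x \<ominus> y" "y \<ominus> x"] le_plus2[of "y \<ominus> x" "x \<ominus> y"] 0
    by (auto simp: mdist_def closed)
  then show "x = y" using assms le_antisym[of x y] by (auto simp: le_zero_iff closed) (simp add: mle_def)
qed (use assms in \<open>auto simp: mdist_def minus_self zero_plus closed\<close>)

lemma dist_commute: "\<lbrakk>x \<in> carrier A; y \<in> carrier A\<rbrakk> \<Longrightarrow> mdist A x y = mdist A y x"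
  by (simp add: mdist_def plus_comm closed)

end

section \<open>Ideals, homomorphisms and quotients\<close>

context mv_algebra
begin

lemma idealD:
  assumes "mv_ideal A I"
  shows "x \<in> I \<Longrightarrow> x \<in> carrier A" "\<zero> \<in> I"
    "\<lbrakk>x \<in> carrier A; y \<in> I; x \<preceq> y\<rbrakk> \<Longrightarrow> x \<in> I" "\<lbrakk>x \<in> I; y \<in> I\<rbrakk> \<Longrightarrow> x \<oplus> y \<in> I"
  using assms by (auto simp: mv_ideal_def)

lemma ideal_plus_iff:
  assumes "mv_ideal A I" "x \<in> carrier A" "y \<in> carrier A"
  shows "x \<oplus> y \<in> I \<longleftrightarrow> x \<in> I \<and> y \<in> I"
  using assms idealD[OF assms(1)] le_plus le_plus2 by blast

lemma ideal_times:
  assumes "mv_ideal A I" "x \<in> I"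
  shows "mtimes A n x \<in> I"
  using assms by (induction n) (auto simp: idealD[OF assms(1)])

lemma ideal_times_iff:
  assumes "mv_ideal A I" "x \<in> carrier A" "n \<ge> 1"
  shows "mtimes A n x \<in> I \<longleftrightarrow> x \<in> I"
  using assms by (cases n) (auto simp: ideal_plus_iff closed intro: ideal_times)

lemma zero_ideal: "mv_ideal A {\<zero>}"
  using le_zero_iff by (auto simp: mv_ideal_def zero_plus closed)

text \<open>The ideal generated by \<open>I\<close> and \<open>u\<close>, for an ideal \<open>I\<close>.\<close>

definition ideal_adjoin :: "'a set \<Rightarrow> 'a \<Rightarrow> 'a set" where
  "ideal_adjoin I u = {x \<in> carrier A. \<exists>p\<in>I. \<exists>n. x \<preceq> p \<oplus> mtimes A n u}"

lemma ideal_adjoin: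
  assumes I: "mv_ideal A I" and u: "u \<in> carrier A"
  shows "mv_ideal A (ideal_adjoin I u)" "I \<subseteq> ideal_adjoin I u" "u \<in> ideal_adjoin I u"
proof -
  note D = idealD[OF I]
  show sub: "I \<subseteq> ideal_adjoin I u"
  proof
    fix x assume x: "x \<in> I"
    then have "x \<preceq> x \<oplus> mtimes A 0 u" "x \<in> carrier A" using D(1) by (auto simp: plus_zero le_refl)
    then show "x \<in> ideal_adjoin I u" using x unfolding ideal_adjoin_def by blast
  qed
  have "u \<preceq> \<zero> \<oplus> mtimes A 1 u" using u by (simp add: zero_plus plus_zero le_refl)
  then show "u \<in> ideal_adjoin I u" using u D(2) unfolding ideal_adjoin_def by blast
  have "x \<oplus> y \<in> ideal_adjoin I u" if xy: "x \<in> ideal_adjoin I u" "y \<in> ideal_adjoin I u" for x y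
  proof -
    obtain p n q m where *: "x \<in> carrier A" "y \<in> carrier A" "p \<in> I" "q \<in> I"
      "x \<preceq> p \<oplus> mtimes A n u" "y \<preceq> q \<oplus> mtimes A m u"
      using xy unfolding ideal_adjoin_def by blast
    have pq: "p \<in> carrier A" "q \<in> carrier A" "p \<oplus> q \<in> I" using *(3,4) D(1,4) by auto
    have "x \<oplus> y \<preceq> (p \<oplus> mtimes A n u) \<oplus> (q \<oplus> mtimes A m u)"
      using * pq u by (intro plus_mono) (auto simp: closed)
    also have "\<dots> = (p \<oplus> q) \<oplus> mtimes A (n + m) u" using pq u by (simp add: times_add closed plus_ac)
    finally show ?thesis using * pq(3) closed(1) unfolding ideal_adjoin_def by blast
  qed
  moreover have "x \<in> ideal_adjoin I u"
    if xy: "x \<in> carrier A" "y \<in> ideal_adjoin I u" "x \<preceq> y" for x y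
  proof -
    obtain p n where *: "y \<in> carrier A" "p \<in> I" "y \<preceq> p \<oplus> mtimes A n u"
      using xy unfolding ideal_adjoin_def by blast
    then have "x \<preceq> p \<oplus> mtimes A n u"
      using xy u D(1) * by (intro le_trans[of x y "p \<oplus> mtimes A n u"]) (auto simp: closed)
    then show ?thesis using * xy unfolding ideal_adjoin_def by blast
  qed
  ultimately show "mv_ideal A (ideal_adjoin I u)"
    using sub D(2) by (auto simp: mv_ideal_def) (auto simp: ideal_adjoin_def)
qed

lemma primeD:
  assumes "mv_prime A P"
  shows "mv_ideal A P" "\<one> \<notin> P" "\<lbrakk>x \<in> carrier A; y \<in> carrier A\<rbrakk> \<Longrightarrow> x \<ominus> y \<in> P \<or> y \<ominus> x \<in> P"
  using assms by (auto simp: mv_prime_def)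

text \<open>An ideal \<open>P\<close> that is maximal among the ideals avoiding \<open>a\<close> is prime: if neither \<open>u = x \<ominus> y\<close> nor
  \<open>v = y \<ominus> x\<close> were in \<open>P\<close>, adjoining either of them would capture \<open>a\<close>, so that \<open>a \<ominus> r\<close> would lie below
  a multiple of \<open>u\<close> and below a multiple of \<open>v\<close> for one \<open>r \<in> P\<close>. As \<open>u\<close> and \<open>v\<close> are disjoint, so are their
  multiples, and \<open>a \<preceq> r\<close> follows.\<close>

theorem prime_separation:
  assumes I: "mv_ideal A I" and a: "a \<in> carrier A" "a \<notin> I"
  obtains P where "mv_prime A P" "I \<subseteq> P" "a \<notin> P"
proof -
  define \<C> where "\<C> = {J. mv_ideal A J \<and> I \<subseteq> J \<and> a \<notin> J}"
  have "\<exists>M\<in>\<C>. \<forall>J\<in>\<C>. M \<subseteq> J \<longrightarrow> J = M"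
  proof (rule subset_Zorn_nonempty)
    show "\<C> \<noteq> {}" using assms by (auto simp: \<C>_def)
  next
    fix C assume C: "C \<noteq> {}" "subset.chain \<C> C"
    then have CC: "\<And>J. J \<in> C \<Longrightarrow> mv_ideal A J \<and> I \<subseteq> J \<and> a \<notin> J"
      by (auto simp: subset_chain_def \<C>_def)
    have "x \<oplus> y \<in> \<Union>C" if xy: "x \<in> \<Union>C" "y \<in> \<Union>C" for x y
    proof -
      obtain J K where JK: "J \<in> C" "x \<in> J" "K \<in> C" "y \<in> K" using xy by blast
      then have "J \<subseteq> K \<or> K \<subseteq> J" using C(2) by (auto simp: subset_chain_def)
      then have "x \<in> K \<and> y \<in> K \<or> x \<in> J \<and> y \<in> J" using JK by blast
      then show ?thesis using JK(1,3) CC idealD(4) by (meson UnionI)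
    qed
    moreover have "\<zero> \<in> \<Union>C" "\<Union>C \<subseteq> carrier A" "I \<subseteq> \<Union>C" "a \<notin> \<Union>C"
      using C(1) CC unfolding mv_ideal_def by blast+
    moreover have "x \<in> \<Union>C" if "x \<in> carrier A" "y \<in> \<Union>C" "x \<preceq> y" for x y
      using that CC idealD(3) by (meson UnionE UnionI)
    ultimately show "\<Union>C \<in> \<C>" unfolding \<C>_def mv_ideal_def mem_Collect_eq by blast
  qed
  then obtain P where PC: "P \<in> \<C>" "\<forall>J\<in>\<C>. P \<subseteq> J \<longrightarrow> J = P" by blast
  then have P: "mv_ideal A P" "I \<subseteq> P" "a \<notin> P" by (auto simp: \<C>_def)
  have max: "J = P" if "mv_ideal A J" "P \<subseteq> J" "a \<notin> J" for J
    using PC(2) P(2) that by (auto simp: \<C>_def)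
  note D = idealD[OF P(1)]
  have capture: "\<exists>p\<in>P. \<exists>n. a \<preceq> p \<oplus> mtimes A n u" if "u \<in> carrier A" "u \<notin> P" for u
    using max[of "ideal_adjoin P u"] ideal_adjoin[OF P(1) that(1)] that by (auto simp: ideal_adjoin_def)
  have "x \<ominus> y \<in> P \<or> y \<ominus> x \<in> P" if xy: "x \<in> carrier A" "y \<in> carrier A" for x y
  proof (rule ccontr)
    define u v where "u = x \<ominus> y" and "v = y \<ominus> x"
    have uv: "u \<in> carrier A" "v \<in> carrier A" using xy by (auto simp: u_def v_def closed)
    assume "\<not> ?thesis"
    then have "u \<notin> P" "v \<notin> P" by (auto simp: u_def v_def)
    then obtain p n q m where pq: "p \<in> P" "a \<preceq> p \<oplus> mtimes A n u" "q \<in> P" "a \<preceq> q \<oplus> mtimes A m v"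
      using capture uv by meson
    have pq': "p \<in> carrier A" "q \<in> carrier A" "p \<oplus> q \<in> P" using pq(1,3) D(1,4) by auto
    have below: "a \<ominus> (p \<oplus> q) \<preceq> mtimes A k w"
      if "a \<preceq> s \<oplus> mtimes A k w" "s \<in> carrier A" "w \<in> carrier A" "s \<preceq> p \<oplus> q" for s k w
    proof -
      have "s \<oplus> mtimes A k w \<preceq> (p \<oplus> q) \<oplus> mtimes A k w"
        using that pq' by (intro plus_mono) (auto simp: closed le_refl)
      then show ?thesis
        using that pq' a le_trans[OF _ _ _ that(1)] by (simp add: minus_le_iff closed)
    qed
    have "disj (mtimes A n u) (mtimes A m v)"
      using uv xy by (metis disj_minus disj_times disj_sym times_closed u_def v_def)
    then have "a \<ominus> (p \<oplus> q) = \<zero>"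
      using below[OF pq(2)] below[OF pq(4)] pq' uv a
      by (auto simp: disj_def le_plus le_plus2 closed)
    then have "a \<in> P" using D(3)[OF a(1) pq'(3)] by (simp add: mle_def)
    then show False using P by simp
  qed
  moreover have "\<one> \<notin> P" using P a D(3) le_one by blast
  ultimately have "mv_prime A P" using P by (auto simp: mv_prime_def)
  then show ?thesis using P that by blast
qed

text \<open>For disjoint \<open>a\<close> and \<open>b\<close> the truncated differences are \<open>a\<close> and \<open>b\<close> themselves, so primeness applies to them
  directly.\<close>

lemma prime_disj:
  assumes "mv_prime A P" "a \<in> carrier A" "b \<in> carrier A" "disj a b"
  shows "a \<in> P \<or> b \<in> P"
proof -
  have "a \<preceq> a \<ominus> b" "b \<preceq> b \<ominus> a" using assms disj_meet disj_sym by blast+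
  then show ?thesis
    using primeD[OF assms(1)] idealD[OF primeD(1)[OF assms(1)]] assms closed(5) by blast
qed

lemma dist_in_ideal_iff:
  assumes "mv_ideal A I" "x \<in> carrier A" "y \<in> carrier A"
  shows "mdist A x y \<in> I \<longleftrightarrow> x \<ominus> y \<in> I \<and> y \<ominus> x \<in> I"
  using assms by (simp add: mdist_def ideal_plus_iff closed)

lemma equiv_cong:
  assumes I: "mv_ideal A I"
  shows "equiv (carrier A) (mv_cong A I)"
proof (rule equivI)
  show "mv_cong A I \<subseteq> carrier A \<times> carrier A" by (auto simp: mv_cong_def)
  show "refl_on (carrier A) (mv_cong A I)"
    using idealD(2)[OF I] by (auto simp: refl_on_def mv_cong_def dist_zero_iff[THEN iffD2])
  show "sym (mv_cong A I)" by (auto simp: sym_def mv_cong_def dist_commute)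
  have *: "x \<ominus> z \<in> I"
    if "x \<in> carrier A" "y \<in> carrier A" "z \<in> carrier A" "x \<ominus> y \<in> I" "y \<ominus> z \<in> I" for x y z
    using idealD(3)[OF I closed(5) idealD(4)[OF I that(4,5)] minus_triangle] that(1-3) by blast
  show "trans (mv_cong A I)"
  proof (rule transI)
    fix x y z assume "(x, y) \<in> mv_cong A I" "(y, z) \<in> mv_cong A I"
    then show "(x, z) \<in> mv_cong A I"
      using *[of x y z] *[of z y x] by (auto simp: mv_cong_def dist_in_ideal_iff I)
  qed
qed

lemma class_eq_iff:
  assumes "mv_ideal A I" "x \<in> carrier A" "y \<in> carrier A"
  shows "mv_cong A I `` {x} = mv_cong A I `` {y} \<longleftrightarrow> mdist A x y \<in> I"
  using eq_equiv_class_iff[OF equiv_cong[OF assms(1)] assms(2,3)] assms by (auto simp: mv_cong_def)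

lemma in_class_iff:
  assumes "mv_ideal A I"
  shows "y \<in> mv_cong A I `` {x} \<longleftrightarrow>
    x \<in> carrier A \<and> y \<in> carrier A \<and> x \<ominus> y \<in> I \<and> y \<ominus> x \<in> I"
  by (auto simp: mv_cong_def dist_in_ideal_iff assms)

lemma quot_plus:
  assumes I: "mv_ideal A I" and xy: "x \<in> carrier A" "y \<in> carrier A"
  shows "mplus (mv_quot A I) (mv_cong A I `` {x}) (mv_cong A I `` {y}) = mv_cong A I `` {x \<oplus> y}"
proof -
  have le: "(a \<oplus> b) \<ominus> (a' \<oplus> b') \<in> I"
    if "a \<in> carrier A" "b \<in> carrier A" "a' \<in> carrier A" "b' \<in> carrier A" "a \<ominus> a' \<in> I" "b \<ominus> b' \<in> I"
    for a b a' b'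
    using idealD(3)[OF I _ idealD(4)[OF I that(5,6)] plus_minus_plus_le] that by (simp add: closed)
  have "mv_cong A I `` {x' \<oplus> y'} = mv_cong A I `` {x \<oplus> y}"
    if "x' \<in> mv_cong A I `` {x}" "y' \<in> mv_cong A I `` {y}" for x' y'
    using that[unfolded in_class_iff[OF I]] xy le by (simp add: class_eq_iff I closed dist_in_ideal_iff)
  moreover have "x \<in> mv_cong A I `` {x}" "y \<in> mv_cong A I `` {y}"
    using equiv_class_self[OF equiv_cong[OF I]] xy by auto
  ultimately show ?thesis unfolding mv_quot_def mv.simps by blast
qed

lemma quot_neg:
  assumes I: "mv_ideal A I" and x: "x \<in> carrier A"
  shows "mneg (mv_quot A I) (mv_cong A I `` {x}) = mv_cong A I `` {\<sim> x}"
proof -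
  have "mv_cong A I `` {\<sim> x'} = mv_cong A I `` {\<sim> x}" if "x' \<in> mv_cong A I `` {x}" for x'
    using that[unfolded in_class_iff[OF I]] x
    by (simp add: class_eq_iff I closed dist_in_ideal_iff neg_minus_neg)
  moreover have "x \<in> mv_cong A I `` {x}"
    using equiv_class_self[OF equiv_cong[OF I] x] by auto
  ultimately show ?thesis unfolding mv_quot_def mv.simps by blast
qed

end

lemma mv_homD:
  assumes "h \<in> mv_hom A B"
  shows "h \<in> extensional (carrier A)" "x \<in> carrier A \<Longrightarrow> h x \<in> carrier B"
    "\<lbrakk>x \<in> carrier A; y \<in> carrier A\<rbrakk> \<Longrightarrow> h (x \<oplus>\<^bsub>A\<^esub> y) = h x \<oplus>\<^bsub>B\<^esub> h y"
    "x \<in> carrier A \<Longrightarrow> h (mneg A x) = mneg B (h x)" "h (mzero A) = mzero B"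
  using assms by (auto simp: mv_hom_def PiE_def)

lemma mv_homI:
  assumes "h \<in> extensional (carrier A)" "\<And>x. x \<in> carrier A \<Longrightarrow> h x \<in> carrier B"
    "\<And>x y. \<lbrakk>x \<in> carrier A; y \<in> carrier A\<rbrakk> \<Longrightarrow> h (x \<oplus>\<^bsub>A\<^esub> y) = h x \<oplus>\<^bsub>B\<^esub> h y"
    "\<And>x. x \<in> carrier A \<Longrightarrow> h (mneg A x) = mneg B (h x)" "h (mzero A) = mzero B"
  shows "h \<in> mv_hom A B"
  using assms by (auto simp: mv_hom_def PiE_def)

lemma mv_hom_comp:
  assumes "mv_algebra A" "h \<in> mv_hom A B" "k \<in> mv_hom B C"
  shows "mv_comp A k h \<in> mv_hom A C"
proof -
  interpret mv_algebra A by fact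
  show ?thesis
    by (rule mv_homI) (auto simp: mv_comp_def compose_def closed mv_homD[OF assms(2)] mv_homD[OF assms(3)])
qed

lemma mv_id_hom: "mv_algebra A \<Longrightarrow> mv_id A \<in> mv_hom A A"
  by (rule mv_homI) (auto simp: mv_id_def mv_algebra.closed)

context mv_algebra
begin

context
  fixes B :: "'b mv" and h
  assumes h: "h \<in> mv_hom A B"
begin

lemma hom_one: "h \<one> = mone B"
  by (simp add: mone_def mv_homD[OF h] closed)

lemma hom_minus: "\<lbrakk>x \<in> carrier A; y \<in> carrier A\<rbrakk> \<Longrightarrow> h (x \<ominus> y) = mminus B (h x) (h y)"
  by (simp add: mminus_def mv_homD[OF h] closed)

lemma hom_dist: "\<lbrakk>x \<in> carrier A; y \<in> carrier A\<rbrakk> \<Longrightarrow> h (mdist A x y) = mdist B (h x) (h y)"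
  by (simp add: mdist_def mv_homD[OF h] hom_minus closed)

lemma hom_times: "x \<in> carrier A \<Longrightarrow> h (mtimes A n x) = mtimes B n (h x)"
  by (induction n) (auto simp: mv_homD[OF h] closed)

lemma prime_preimage:
  assumes B: "mv_algebra B" and P: "mv_prime B P"
  shows "mv_prime A {a \<in> carrier A. h a \<in> P}"
proof -
  interpret B: mv_algebra B by fact
  note D = B.idealD[OF B.primeD(1)[OF P]]
  have "mv_ideal A {a \<in> carrier A. h a \<in> P}"
    using D(2,4) D(3)[unfolded mle_def] by (auto simp: mv_ideal_def closed mv_homD[OF h] mle_def)
      (metis hom_minus mv_homD(2,5)[OF h])
  then show ?thesis
    using B.primeD[OF P] by (auto simp: mv_prime_def closed hom_one hom_minus mv_homD[OF h])
qed

text \<open>Apart from closure the axioms are equations, so they pass to surjective images. This makes the stalks \<open>A/P\<close> algebras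
  without inspecting classes.\<close>

lemma image_algebra:
  assumes surj: "h ` carrier A = carrier B"
  shows "mv_algebra B"
proof
  note H = mv_homD(3,4,5)[OF h, symmetric]
  fix x y z assume "x \<in> carrier B" "y \<in> carrier B" "z \<in> carrier B"
  then obtain a b c where abc: "x = h a" "y = h b" "z = h c" "a \<in> carrier A" "b \<in> carrier A" "c \<in> carrier A"
    unfolding surj[symmetric] by blast
  note simps = abc H closed imageI
  show "(x \<oplus>\<^bsub>B\<^esub> y) \<oplus>\<^bsub>B\<^esub> z = x \<oplus>\<^bsub>B\<^esub> (y \<oplus>\<^bsub>B\<^esub> z)" by (simp add: simps plus_assoc)
next
  note H = mv_homD(3,4,5)[OF h, symmetric]
  fix x y assume "x \<in> carrier B" "y \<in> carrier B"
  then obtain a b where ab: "x = h a" "y = h b" "a \<in> carrier A" "b \<in> carrier A"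
    unfolding surj[symmetric] by blast
  note simps = ab H closed imageI
  show "x \<oplus>\<^bsub>B\<^esub> y \<in> carrier B" unfolding surj[symmetric] by (simp add: simps)
  show "x \<oplus>\<^bsub>B\<^esub> y = y \<oplus>\<^bsub>B\<^esub> x" by (simp add: simps plus_comm)
  show "mneg B (mneg B x \<oplus>\<^bsub>B\<^esub> y) \<oplus>\<^bsub>B\<^esub> y = mneg B (mneg B y \<oplus>\<^bsub>B\<^esub> x) \<oplus>\<^bsub>B\<^esub> x"
    using lukasiewicz[of a b] by (simp add: simps)
  show "mneg B x \<in> carrier B" unfolding surj[symmetric] by (simp add: simps)
  show "x \<oplus>\<^bsub>B\<^esub> mzero B = x" "mneg B (mneg B x) = x" "x \<oplus>\<^bsub>B\<^esub> mneg B (mzero B) = mneg B (mzero B)"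
    by (simp_all add: simps plus_zero neg_neg plus_neg_zero)
next
  show "mzero B \<in> carrier B" using surj mv_homD(5)[OF h] closed(3) by (metis imageI)
qed

end

end

lemma chain_algebra: "mv_chain B \<Longrightarrow> mv_algebra B"
  by (simp add: mv_chain_def)

lemma chain_zero_prime:
  assumes "mv_chain B"
  shows "mv_prime B {mzero B}"
  using assms mv_algebra.zero_ideal[OF chain_algebra]
  by (auto simp: mv_prime_def mv_chain_def mv_nontrivial_def mle_def)

text \<open>The kernel of a homomorphism into a chain is a proper ideal, hence trivial if the source is
  simple.\<close>

lemma simple_hom_inj:
  assumes A: "mv_simple A" and B: "mv_chain B" and h: "h \<in> mv_hom A B"
  shows "inj_on h (carrier A)"
proof (rule inj_onI)
  interpret mv_algebra A using A by (simp add: mv_simple_def)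
  interpret B: mv_algebra B using B by (rule chain_algebra)
  define K where "K = {a \<in> carrier A. h a \<in> {mzero B}}"
  have "mv_prime A K" unfolding K_def by (rule prime_preimage[OF h chain_algebra[OF B] chain_zero_prime[OF B]])
  then have "mv_ideal A K" "K \<noteq> carrier A" using primeD one_closed by blast+
  then have K: "K = {mzero A}" using A by (auto simp: mv_simple_def)
  fix x y assume "x \<in> carrier A" "y \<in> carrier A" "h x = h y"
  then have "mdist A x y \<in> K"
    by (simp add: K_def hom_dist[OF h] closed B.dist_zero_iff mv_homD[OF h])
  then show "x = y" using \<open>x \<in> _\<close> \<open>y \<in> _\<close> by (simp add: K dist_zero_iff)
qed

text \<open>The ideal generated by a nonzero element of a simple algebra contains \<open>1\<close>, that is, \<open>1\<close> lies below
  a multiple of that element.\<close>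

lemma simple_times_one:
  assumes "mv_simple A" "a \<in> carrier A" "a \<noteq> mzero A"
  obtains n where "mtimes A n a = mone A"
proof -
  interpret mv_algebra A using assms by (simp add: mv_simple_def)
  note J = ideal_adjoin[OF zero_ideal assms(2)]
  have "ideal_adjoin {mzero A} a = carrier A"
    using assms J by (fastforce simp: mv_simple_def)
  then have "mone A \<in> ideal_adjoin {mzero A} a" using one_closed by simp
  then obtain n where "mle A (mone A) (mtimes A n a)"
    using assms by (auto simp: ideal_adjoin_def zero_plus closed)
  then have "mtimes A n a = mone A" using assms by (intro le_antisym) (auto simp: closed le_one)
  then show ?thesis by (rule that)
qed

lemma hyperarchimedean_algebra: "hyperarchimedean A \<Longrightarrow> mv_algebra A"
  by (simp add: hyperarchimedean_def)

text \<open>The pivot of the whole equivalence: if \<open>n a = (n + 1) a\<close>, then \<open>e = n a\<close> behaves like a Boolean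
  element. Since \<open>a\<close> and \<open>\<not> e\<close> are disjoint, a prime ideal contains one of them, and it cannot contain
  both, as \<open>e \<oplus> \<not> e = 1\<close>.\<close>

lemma hyperarchimedean_boolean:
  assumes A: "hyperarchimedean A" and a: "a \<in> carrier A"
  obtains e where "e \<in> carrier A"
    "\<And>P. mv_prime A P \<Longrightarrow> e \<in> P \<longleftrightarrow> a \<in> P" "\<And>P. mv_prime A P \<Longrightarrow> mneg A e \<in> P \<longleftrightarrow> a \<notin> P"
proof -
  interpret mv_algebra A using A by (rule hyperarchimedean_algebra)
  obtain n where n: "n \<ge> 1" "mtimes A n a = mtimes A (n + 1) a"
    using A a unfolding hyperarchimedean_def by blast
  define e where "e = mtimes A n a"
  have e: "e \<in> carrier A" using a by (simp add: e_def closed)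
  have "e \<oplus>\<^bsub>A\<^esub> a = mtimes A (n + 1) a" using a by (simp add: e_def plus_comm closed)
  also have "\<dots> = e" unfolding e_def by (rule n(2)[symmetric])
  finally have "disj a (mneg A e)" using a e by (intro disj_absorbed)
  moreover have "\<not> (e \<in> P \<and> mneg A e \<in> P)" if "mv_prime A P" for P
    using primeD[OF that] idealD(4)[OF primeD(1)[OF that], of e "mneg A e"] plus_neg[OF e] by auto
  moreover have eP: "e \<in> P \<longleftrightarrow> a \<in> P" if "mv_prime A P" for P
    using ideal_times_iff[OF primeD(1)[OF that] a n(1)] by (simp add: e_def)
  ultimately have "mneg A e \<in> P \<longleftrightarrow> a \<notin> P" if "mv_prime A P" for P
    using prime_disj[OF that a closed(2)[OF e]] that by blast
  with e eP show ?thesis by (rule that)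
qed

lemma hyperarchimedean_image:
  assumes A: "hyperarchimedean A" and h: "h \<in> mv_hom A B" and surj: "h ` carrier A = carrier B"
  shows "hyperarchimedean B"
proof -
  interpret mv_algebra A using A by (rule hyperarchimedean_algebra)
  have "\<exists>n\<ge>1. mtimes B n b = mtimes B (n + 1) b" if "b \<in> carrier B" for b
  proof -
    have "b \<in> h ` carrier A" using that surj by simp
    then obtain a where a: "a \<in> carrier A" "b = h a" by blast
    obtain n where n: "n \<ge> 1" "mtimes A n a = mtimes A (n + 1) a"
      using A a(1) unfolding hyperarchimedean_def by blast
    have "mtimes B n b = mtimes B (n + 1) b"
      unfolding a(2) hom_times[OF h a(1), symmetric] by (rule arg_cong[OF n(2)])
    then show ?thesis using n(1) by blast
  qed
  then show ?thesis using image_algebra[OF h surj] unfolding hyperarchimedean_def by blast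
qed

text \<open>In a chain the zero ideal is itself prime. For a nonzero \<open>a\<close> the complementary element of the
  preceding lemma therefore lies in the zero ideal, hence in every prime; so \<open>a\<close> lies in no prime and
  a fortiori in no proper ideal.\<close>

lemma hyperarchimedean_chain_simple:
  assumes A: "hyperarchimedean A" and chain: "mv_chain A"
  shows "mv_simple A"
proof -
  interpret mv_algebra A using A by (rule hyperarchimedean_algebra)
  have "I = {mzero A}" if I: "mv_ideal A I" "I \<noteq> carrier A" for I
  proof -
    obtain z where "z \<in> carrier A" "z \<notin> I" using I idealD(1) by blast
    then obtain P where P: "mv_prime A P" "I \<subseteq> P" using prime_separation I(1) by metis
    have "a = mzero A" if "a \<in> I" for a
    proof (rule ccontr)
      assume a: "a \<noteq> mzero A"
      have "a \<in> carrier A" using that I idealD(1) by blast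
      then obtain e where e: "e \<in> carrier A"
        "\<And>P. mv_prime A P \<Longrightarrow> mneg A e \<in> P \<longleftrightarrow> a \<notin> P"
        using hyperarchimedean_boolean[OF A] by metis
      have "mneg A e = mzero A" using e(2)[OF chain_zero_prime[OF chain]] a by simp
      then have "a \<notin> P" using e(2)[OF P(1)] idealD(2)[OF primeD(1)[OF P(1)]] by simp
      then show False using that P by blast
    qed
    then show ?thesis using idealD(2)[OF I(1)] by blast
  qed
  then show ?thesis using chain by (auto simp: mv_simple_def mv_chain_def)
qed

lemma subalgebra_prod_algebra:
  assumes F: "\<And>i. i \<in> U \<Longrightarrow> mv_algebra (F i)" and S: "mv_subalgebra S (mv_prod U F)"
  shows "mv_algebra ((mv_prod U F)\<lparr>carrier := S\<rparr>)"
proof -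
  have val: "s i \<in> carrier (F i)" if "s \<in> S" "i \<in> U" for s i
    using S that by (auto simp: mv_subalgebra_def mv_prod_def)
  have ext: "s i = undefined" if "s \<in> S" "i \<notin> U" for s i
    using S that by (auto simp: mv_subalgebra_def mv_prod_def)
  note ax = F[THEN mv_algebra.plus_assoc] F[THEN mv_algebra.plus_comm] F[THEN mv_algebra.plus_zero]
    F[THEN mv_algebra.neg_neg] F[THEN mv_algebra.plus_neg_zero] F[THEN mv_algebra.lukasiewicz]
  show ?thesis
  proof
    fix x y z assume "x \<in> carrier ((mv_prod U F)\<lparr>carrier := S\<rparr>)" "y \<in> carrier ((mv_prod U F)\<lparr>carrier := S\<rparr>)"
      "z \<in> carrier ((mv_prod U F)\<lparr>carrier := S\<rparr>)"
    then have "x \<in> S" "y \<in> S" "z \<in> S" by auto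
    then show "mplus ((mv_prod U F)\<lparr>carrier := S\<rparr>) (mplus ((mv_prod U F)\<lparr>carrier := S\<rparr>) x y) z =
      mplus ((mv_prod U F)\<lparr>carrier := S\<rparr>) x (mplus ((mv_prod U F)\<lparr>carrier := S\<rparr>) y z)"
      by (auto simp: mv_prod_def fun_eq_iff val ax(1))
  qed (use S in \<open>auto simp: mv_subalgebra_def mv_prod_def fun_eq_iff val ext ax(2-5) intro!: ax(6)\<close>)
qed

section \<open>Sections of a local homeomorphism\<close>

lemma sectionsD:
  assumes "s \<in> sections X U"
  shows "s \<in> extensional U" "x \<in> U \<Longrightarrow> proj X (s x) = x"
    "\<lbrakk>x \<in> U; x \<in> pts X\<rbrakk> \<Longrightarrow> s x \<in> topspace (total_space X)"
  using assms by (auto simp: sections_def continuous_map_def)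

lemma sections_preimage_open:
  assumes s: "s \<in> sections X U" and U: "openin (base_space X) U" and G: "openin (total_space X) G"
  shows "openin (base_space X) {x \<in> U. s x \<in> G}"
proof -
  have U_pts: "pts X \<inter> U = U" using openin_subset[OF U] by blast
  have "openin (subtopology (base_space X) U) {x \<in> topspace (subtopology (base_space X) U). s x \<in> G}"
    using s G unfolding sections_def continuous_map_def by blast
  then have "openin (subtopology (base_space X) U) {x \<in> U. s x \<in> G}" by (simp add: U_pts)
  then show ?thesis using openin_trans_full U by blast
qed

lemma sectionsI:
  assumes U: "openin (base_space X) U" and "s \<in> extensional U"
    and "\<And>x. x \<in> U \<Longrightarrow> s x \<in> topspace (total_space X) \<and> proj X (s x) = x"
    and pre: "\<And>G. openin (total_space X) G \<Longrightarrow> openin (base_space X) {x \<in> U. s x \<in> G}"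
  shows "s \<in> sections X U"
proof -
  have U_pts: "pts X \<inter> U = U" using openin_subset[OF U] by blast
  have "openin (subtopology (base_space X) U) {x \<in> U. s x \<in> G}" if "openin (total_space X) G" for G
    using pre[OF that] U by (simp add: openin_open_subtopology)
  then show ?thesis using assms(2,3) by (auto simp: sections_def continuous_map_def U_pts)
qed

lemma sections_restrict:
  assumes s: "s \<in> sections X U" and U: "openin (base_space X) U"
    and V: "openin (base_space X) V" "V \<subseteq> U"
  shows "restrict s V \<in> sections X V"
proof (rule sectionsI[OF V(1)])
  fix G assume "openin (total_space X) G"
  then have "openin (base_space X) ({x \<in> U. s x \<in> G} \<inter> V)"
    using sections_preimage_open[OF s U] V by blast
  also have "{x \<in> U. s x \<in> G} \<inter> V = {x \<in> V. restrict s V x \<in> G}" using V by auto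
  finally show "openin (base_space X) {x \<in> V. restrict s V x \<in> G}" .
qed (use V sectionsD[OF s] openin_subset[OF U] in auto)

lemma sections_local:
  assumes U: "openin (base_space X) U" and ext: "s \<in> extensional U"
    and loc: "\<And>x. x \<in> U \<Longrightarrow> \<exists>V t. openin (base_space X) V \<and> x \<in> V \<and> t \<in> sections X V \<and> (\<forall>y\<in>V \<inter> U. s y = t y)"
  shows "s \<in> sections X U"
proof (rule sectionsI[OF U ext])
  fix x assume x: "x \<in> U"
  then obtain V t where V: "openin (base_space X) V" "x \<in> V" "t \<in> sections X V" "s x = t x"
    using loc by blast
  then have "x \<in> pts X" using openin_subset by blast
  then show "s x \<in> topspace (total_space X) \<and> proj X (s x) = x" using sectionsD[OF V(3)] V by auto
next
  fix G assume G: "openin (total_space X) G"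
  have "\<exists>T. openin (base_space X) T \<and> x \<in> T \<and> T \<subseteq> {x \<in> U. s x \<in> G}" if x: "x \<in> U" "s x \<in> G" for x
  proof -
    obtain V t where V: "openin (base_space X) V" "x \<in> V" "t \<in> sections X V" "\<forall>y\<in>V \<inter> U. s y = t y"
      using loc x(1) by blast
    have "openin (base_space X) ({y \<in> V. t y \<in> G} \<inter> U)"
      using sections_preimage_open[OF V(3,1) G] U by blast
    moreover have "x \<in> {y \<in> V. t y \<in> G} \<inter> U" "{y \<in> V. t y \<in> G} \<inter> U \<subseteq> {x \<in> U. s x \<in> G}"
      using V x by auto
    ultimately show ?thesis by blast
  qed
  then show "openin (base_space X) {x \<in> U. s x \<in> G}" by (subst openin_subopen) blast
qed

text \<open>Near a common value the projection is injective, so two sections that meet at a point agree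
  around it.\<close>

lemma sections_agree_open:
  assumes lh: "local_homeomorphism (total_space X) (base_space X) (proj X)"
    and U: "openin (base_space X) U" and s: "s \<in> sections X U" and t: "t \<in> sections X U"
  shows "openin (base_space X) {x \<in> U. s x = t x}"
proof -
  have "\<exists>T. openin (base_space X) T \<and> x \<in> T \<and> T \<subseteq> {x \<in> U. s x = t x}" if x: "x \<in> U" "s x = t x" for x
  proof -
    have "x \<in> pts X" using x U openin_subset by blast
    then have "s x \<in> topspace (total_space X)" using sectionsD[OF s] x by blast
    then obtain G where G: "openin (total_space X) G" "s x \<in> G"
      and "homeomorphic_map (subtopology (total_space X) G) (subtopology (base_space X) (proj X ` G)) (proj X)"
      using lh unfolding local_homeomorphism_def by blast
    then have inj: "inj_on (proj X) G"
      using openin_subset[OF G(1)] by (simp add: homeomorphic_map_def Int_absorb1)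
    have "openin (base_space X) ({y \<in> U. s y \<in> G} \<inter> {y \<in> U. t y \<in> G})"
      using sections_preimage_open[OF s U G(1)] sections_preimage_open[OF t U G(1)] by blast
    moreover have "s y = t y" if "y \<in> U" "s y \<in> G" "t y \<in> G" for y
      using inj_onD[OF inj _ that(2,3)] sectionsD(2)[OF s that(1)] sectionsD(2)[OF t that(1)] by simp
    ultimately show ?thesis using x G by (intro exI[of _ "{y \<in> U. s y \<in> G} \<inter> {y \<in> U. t y \<in> G}"]) auto
  qed
  then show ?thesis by (subst openin_subopen) blast
qed

section \<open>The prime spectrum as an MV-space\<close>

lemma Spec_simps: "proj (Spec A) = fst" "stalk (Spec A) = tagged_quot A"
  by (simp_all add: Spec_def)

context mv_algebra
begin

lemma primes_ideal: "P \<in> primes A \<Longrightarrow> mv_ideal A P"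
  by (simp add: primes_def primeD)

lemma hat_eq_iff:
  assumes "P \<in> primes A" "x \<in> carrier A" "y \<in> carrier A"
  shows "hat A x P = hat A y P \<longleftrightarrow> mdist A x y \<in> P"
  using class_eq_iff[OF primes_ideal[OF assms(1)] assms(2,3)] assms(1) by (simp add: hat_def)

lemma hat_eq_zero_iff:
  assumes "P \<in> primes A" "x \<in> carrier A"
  shows "hat A x P = mzero (tagged_quot A P) \<longleftrightarrow> x \<in> P"
proof -
  have "hat A x P = mzero (tagged_quot A P) \<longleftrightarrow> hat A x P = hat A \<zero> P"
    using assms by (simp add: hat_def tagged_quot_def mv_quot_def)
  also have "\<dots> \<longleftrightarrow> x \<in> P"
    using assms by (simp add: hat_eq_iff closed mdist_def minus_zero mle_def[symmetric] zero_le)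
      (simp add: zero_le[unfolded mle_def] plus_zero)
  finally show ?thesis .
qed

lemma carrier_tagged_quot:
  assumes "P \<in> primes A"
  shows "carrier (tagged_quot A P) = (\<lambda>a. hat A a P) ` carrier A"
  using assms by (auto simp: tagged_quot_def mv_quot_def hat_def quotient_def)

lemma hat_hom:
  assumes P: "P \<in> primes A"
  shows "(\<lambda>a\<in>carrier A. hat A a P) \<in> mv_hom A (tagged_quot A P)"
  using assms quot_plus[OF primes_ideal[OF P]] quot_neg[OF primes_ideal[OF P]]
  by (intro mv_homI)
    (auto simp: carrier_tagged_quot closed hat_def, auto simp: tagged_quot_def mv_quot_def)

lemma hat_simps:
  assumes P: "P \<in> primes A"
  shows "\<lbrakk>x \<in> carrier A; y \<in> carrier A\<rbrakk> \<Longrightarrow>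
      mplus (tagged_quot A P) (hat A x P) (hat A y P) = hat A (x \<oplus> y) P"
    "x \<in> carrier A \<Longrightarrow> mneg (tagged_quot A P) (hat A x P) = hat A (\<sim> x) P"
    "mzero (tagged_quot A P) = hat A \<zero> P"
  using mv_homD(3-5)[OF hat_hom[OF P]] by (simp_all add: closed)

lemma tagged_quot_algebra: "P \<in> primes A \<Longrightarrow> mv_algebra (tagged_quot A P)"
  using image_algebra[OF hat_hom] by (simp add: carrier_tagged_quot)

lemma tagged_quot_chain:
  assumes P: "P \<in> primes A"
  shows "mv_chain (tagged_quot A P)"
proof -
  note Pr = primeD[OF P[unfolded primes_def mem_Collect_eq]]
  let ?h = "\<lambda>a\<in>carrier A. hat A a P"
  have le: "mle (tagged_quot A P) (hat A x P) (hat A y P)"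
    if xy: "x \<in> carrier A" "y \<in> carrier A" "x \<ominus> y \<in> P" for x y
    using hom_minus[OF hat_hom[OF P] xy(1,2)] xy P hat_eq_zero_iff[OF P closed(5)[OF xy(1,2)]]
    by (simp add: mle_def closed)
  have "mone (tagged_quot A P) \<noteq> mzero (tagged_quot A P)"
    using hom_one[OF hat_hom[OF P]] hat_eq_zero_iff[OF P one_closed] Pr(2) by (simp add: closed)
  moreover have "mle (tagged_quot A P) u v \<or> mle (tagged_quot A P) v u"
    if "u \<in> carrier (tagged_quot A P)" "v \<in> carrier (tagged_quot A P)" for u v
    using that le Pr(3) unfolding carrier_tagged_quot[OF P] by fast
  ultimately show ?thesis
    using tagged_quot_algebra[OF P] by (simp add: mv_chain_def mv_nontrivial_def)
qed

lemma W_subset: "W A a \<subseteq> primes A"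
  by (auto simp: W_def)

lemma W_zero: "W A \<zero> = primes A"
  using idealD(2)[OF primes_ideal] by (auto simp: W_def)

lemma W_plus: "\<lbrakk>a \<in> carrier A; b \<in> carrier A\<rbrakk> \<Longrightarrow> W A (a \<oplus> b) = W A a \<inter> W A b"
  using ideal_plus_iff[OF primes_ideal] by (auto simp: W_def)

lemma openin_Spec:
  "openin (base_space (Spec A)) U \<longleftrightarrow> (\<forall>P\<in>U. \<exists>a\<in>carrier A. P \<in> W A a \<and> W A a \<subseteq> U)"
proof -
  have "istopology (arbitrary union_of (\<lambda>U. \<exists>a\<in>carrier A. U = W A a))"
    by (rule istopology_base) (metis W_plus closed(1))
  then show ?thesis
    by (simp add: Spec_def topology_inverse' arbitrary_union_of_alt) blast
qed

lemma W_open: "a \<in> carrier A \<Longrightarrow> openin (base_space (Spec A)) (W A a)"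
  by (auto simp: openin_Spec)

lemma pts_Spec: "pts (Spec A) = primes A"
proof
  show "pts (Spec A) \<subseteq> primes A"
    using openin_topspace[of "base_space (Spec A)"] W_subset unfolding openin_Spec by blast
  show "primes A \<subseteq> pts (Spec A)"
    using openin_subset[OF W_open[OF zero_closed]] by (simp add: W_zero)
qed

text \<open>The basic open sets of the total space are closed under intersection because two classes
  \<open>[a]\<close> and \<open>[a']\<close> agree exactly at the primes containing the distance of \<open>a\<close> and \<open>a'\<close>.\<close>

lemma hat_image_Int:
  assumes "a \<in> carrier A" "b \<in> carrier A" "a' \<in> carrier A" "b' \<in> carrier A"
  shows "hat A a ` W A b \<inter> hat A a' ` W A b' = hat A a ` W A (b \<oplus> (b' \<oplus> mdist A a a'))"
proof -
  \<comment> \<open>Points of the total space carry their prime as a tag, so equal points lie over equal primes.\<close>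
  have eq: "P = Q \<and> mdist A a a' \<in> P"
    if "P \<in> primes A" "Q \<in> primes A" "hat A a P = hat A a' Q" for P Q
  proof -
    have "P = Q" using that by (simp add: hat_def)
    then show ?thesis using that hat_eq_iff assms by blast
  qed
  have W: "W A (b \<oplus> (b' \<oplus> mdist A a a')) = W A b \<inter> (W A b' \<inter> W A (mdist A a a'))"
    using assms by (simp add: W_plus closed)
  show ?thesis
  proof (intro equalityI subsetI)
    fix e assume "e \<in> hat A a ` W A b \<inter> hat A a' ` W A b'"
    then obtain P Q where PQ: "P \<in> W A b" "Q \<in> W A b'" "e = hat A a P" "e = hat A a' Q" by blast
    then have "P = Q \<and> mdist A a a' \<in> P" using eq[of P Q] W_subset by blast
    then have "P \<in> W A b \<inter> (W A b' \<inter> W A (mdist A a a'))" using PQ(1,2) by (auto simp: W_def)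
    then show "e \<in> hat A a ` W A (b \<oplus> (b' \<oplus> mdist A a a'))" unfolding W PQ(3) by (rule imageI)
  next
    fix e assume "e \<in> hat A a ` W A (b \<oplus> (b' \<oplus> mdist A a a'))"
    then obtain P where P: "P \<in> W A b" "P \<in> W A b'" "mdist A a a' \<in> P" "e = hat A a P"
      unfolding W by (auto simp: W_def)
    then have "e = hat A a' P" using hat_eq_iff[of P a a'] assms by (simp add: W_def)
    then show "e \<in> hat A a ` W A b \<inter> hat A a' ` W A b'" using P by blast
  qed
qed

lemma openin_Spec_total:
  "openin (total_space (Spec A)) G \<longleftrightarrow>
    (\<forall>e\<in>G. \<exists>a\<in>carrier A. \<exists>b\<in>carrier A. e \<in> hat A a ` W A b \<and> hat A a ` W A b \<subseteq> G)"
proof -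
  have "istopology (arbitrary union_of (\<lambda>U. \<exists>a\<in>carrier A. \<exists>b\<in>carrier A. U = hat A a ` W A b))"
    by (rule istopology_base) (metis hat_image_Int closed(1,6))
  then show ?thesis
    by (simp add: Spec_def topology_inverse' arbitrary_union_of_alt) blast
qed

lemma hat_image_open:
  assumes a: "a \<in> carrier A" and V: "openin (base_space (Spec A)) V"
  shows "openin (total_space (Spec A)) (hat A a ` V)"
  unfolding openin_Spec_total
proof
  fix e assume "e \<in> hat A a ` V"
  then obtain P where P: "P \<in> V" "e = hat A a P" by blast
  then obtain b where "b \<in> carrier A" "P \<in> W A b" "W A b \<subseteq> V" using V unfolding openin_Spec by meson
  then show "\<exists>c\<in>carrier A. \<exists>b\<in>carrier A. e \<in> hat A c ` W A b \<and> hat A c ` W A b \<subseteq> hat A a ` V"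
    using a P(2) by (intro bexI[of _ a] bexI[of _ b]) auto
qed

lemma topspace_Spec_total:
  "topspace (total_space (Spec A)) = {hat A a P | a P. a \<in> carrier A \<and> P \<in> primes A}" (is "_ = ?E")
proof
  show "topspace (total_space (Spec A)) \<subseteq> ?E"
    using openin_topspace[of "total_space (Spec A)"] W_subset unfolding openin_Spec_total by blast
  show "?E \<subseteq> topspace (total_space (Spec A))"
    using openin_subset[OF hat_image_open[OF _ W_open[OF zero_closed]]] by (auto simp: W_zero)
qed

lemma fst_hat: "P \<in> primes A \<Longrightarrow> fst (hat A a P) = P"
  by (simp add: hat_def)

lemma hat_section:
  assumes a: "a \<in> carrier A"
  shows "hat A a \<in> sections (Spec A) (primes A)"
proof (rule sectionsI)
  show "openin (base_space (Spec A)) (primes A)" using W_open[OF zero_closed] by (simp add: W_zero)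
  show "hat A a \<in> extensional (primes A)" by (simp add: hat_def)
  show "hat A a P \<in> topspace (total_space (Spec A)) \<and> proj (Spec A) (hat A a P) = P"
    if "P \<in> primes A" for P
    using that a by (auto simp: topspace_Spec_total Spec_simps fst_hat)
  fix G assume G: "openin (total_space (Spec A)) G"
  show "openin (base_space (Spec A)) {P \<in> primes A. hat A a P \<in> G}"
    unfolding openin_Spec
  proof safe
    fix P assume P: "P \<in> primes A" "hat A a P \<in> G"
    then obtain c b where cb: "c \<in> carrier A" "b \<in> carrier A" "hat A a P \<in> hat A c ` W A b" "hat A c ` W A b \<subseteq> G"
      using G unfolding openin_Spec_total by blast
    define d where "d = \<zero> \<oplus> (b \<oplus> mdist A a c)"
    have d: "d \<in> carrier A" using a cb by (simp add: d_def closed)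
    have eq: "hat A a ` primes A \<inter> hat A c ` W A b = hat A a ` W A d"
      using hat_image_Int[OF a zero_closed cb(1,2)] by (simp add: d_def W_zero)
    then obtain Q where Q: "Q \<in> W A d" "hat A a P = hat A a Q" using P cb(3) by blast
    moreover have "Q \<in> primes A" using Q W_subset by blast
    ultimately have "Q = P" using Q(2) P(1) by (simp add: hat_def)
    then have "P \<in> W A d" using Q by simp
    moreover have "W A d \<subseteq> {P \<in> primes A. hat A a P \<in> G}"
      using eq cb(4) W_subset by blast
    ultimately show "\<exists>d\<in>carrier A. P \<in> W A d \<and> W A d \<subseteq> {P \<in> primes A. hat A a P \<in> G}"
      using d by blast
  qed
qed

lemma Spec_local_homeomorphism:
  "local_homeomorphism (total_space (Spec A)) (base_space (Spec A)) (proj (Spec A))"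
  unfolding local_homeomorphism_def
proof
  fix e assume "e \<in> topspace (total_space (Spec A))"
  then obtain a P where aP: "a \<in> carrier A" "P \<in> primes A" "e = hat A a P"
    by (auto simp: topspace_Spec_total)
  let ?U = "hat A a ` primes A"
  have U: "openin (total_space (Spec A)) ?U"
    using hat_image_open[OF aP(1) W_open[OF zero_closed]] by (simp add: W_zero)
  have img: "fst ` ?U = primes A" by (force simp: fst_hat)
  have open_primes: "openin (base_space (Spec A)) (primes A)"
    using openin_topspace[of "base_space (Spec A)"] by (simp add: pts_Spec)
  have sub: "subtopology (base_space (Spec A)) (primes A) = base_space (Spec A)"
    by (metis pts_Spec subtopology_topspace)
  have "continuous_map (subtopology (total_space (Spec A)) ?U) (base_space (Spec A)) fst"
    unfolding continuous_map_def
  proof (intro conjI allI impI ballI funcsetI)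
    show "fst u \<in> pts (Spec A)" if "u \<in> topspace (subtopology (total_space (Spec A)) ?U)" for u
      using that by (auto simp: pts_Spec fst_hat)
    fix V assume V: "openin (base_space (Spec A)) V"
    have pV: "V \<subseteq> primes A" using openin_subset[OF V] by (simp add: pts_Spec)
    have "openin (subtopology (total_space (Spec A)) ?U) (hat A a ` V)"
      using hat_image_open[OF aP(1) V] pV by (simp add: openin_open_subtopology U image_mono)
    also have "hat A a ` V = {u \<in> ?U. fst u \<in> V}"
    proof (intro equalityI subsetI)
      fix u assume "u \<in> {u \<in> ?U. fst u \<in> V}"
      then obtain P where "P \<in> primes A" "u = hat A a P" "fst u \<in> V" by blast
      then show "u \<in> hat A a ` V" by (simp add: fst_hat)
    next
      fix u assume "u \<in> hat A a ` V"
      then obtain P where "P \<in> V" "u = hat A a P" by blast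
      then show "u \<in> {u \<in> ?U. fst u \<in> V}" using pV fst_hat[of P a] by auto
    qed
    finally show "openin (subtopology (total_space (Spec A)) ?U)
        {u \<in> topspace (subtopology (total_space (Spec A)) ?U). fst u \<in> V}"
      using openin_subset[OF U] by (simp add: Int_absorb1)
  qed
  moreover have "continuous_map (base_space (Spec A)) (subtopology (total_space (Spec A)) ?U) (hat A a)"
    using hat_section[OF aP(1)] by (auto simp: sections_def sub continuous_map_in_subtopology pts_Spec)
  ultimately have "homeomorphic_maps (subtopology (total_space (Spec A)) ?U) (base_space (Spec A)) fst (hat A a)"
    by (auto simp: homeomorphic_maps_def pts_Spec fst_hat)
  then have "homeomorphic_map (subtopology (total_space (Spec A)) ?U) (base_space (Spec A)) fst"
    by (rule homeomorphic_maps_imp_map)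
  then show "\<exists>U. openin (total_space (Spec A)) U \<and> e \<in> U \<and> openin (base_space (Spec A)) (proj (Spec A) ` U) \<and>
      homeomorphic_map (subtopology (total_space (Spec A)) U)
        (subtopology (base_space (Spec A)) (proj (Spec A) ` U)) (proj (Spec A))"
    using U aP open_primes by (intro exI[of _ ?U]) (simp add: Spec_simps img sub)
qed

text \<open>Every point of the total space is a value of the section of some element of the algebra, and a section
  through that point agrees with it on a neighbourhood.\<close>

lemma sections_Spec:
  assumes V: "openin (base_space (Spec A)) V"
  shows "s \<in> sections (Spec A) V \<longleftrightarrow> s \<in> extensional V \<and>
    (\<forall>P\<in>V. \<exists>a\<in>carrier A. \<exists>N. openin (base_space (Spec A)) N \<and> P \<in> N \<and> N \<subseteq> V \<and> (\<forall>Q\<in>N. s Q = hat A a Q))"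
    (is "_ \<longleftrightarrow> _ \<and> ?loc s")
proof (intro iffI conjI)
  have pV: "V \<subseteq> primes A" using openin_subset[OF V] by (simp add: pts_Spec)
  have open_primes: "openin (base_space (Spec A)) (primes A)"
    using openin_topspace[of "base_space (Spec A)"] by (simp add: pts_Spec)
  have res: "restrict (hat A a) N \<in> sections (Spec A) N"
    if "a \<in> carrier A" "openin (base_space (Spec A)) N" "N \<subseteq> V" for a N
    using sections_restrict[OF hat_section[OF that(1)] open_primes that(2)] that(3) pV by blast
  {
    assume s: "s \<in> sections (Spec A) V"
    then show "s \<in> extensional V" by (rule sectionsD)
    show "?loc s"
    proof
      fix P assume P: "P \<in> V"
      then have "P \<in> primes A" using pV by blast
      then obtain a Q where aQ: "a \<in> carrier A" "Q \<in> primes A" "s P = hat A a Q"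
        using sectionsD(3)[OF s P] by (auto simp: topspace_Spec_total pts_Spec)
      have "Q = P" using sectionsD(2)[OF s P] aQ(3) fst_hat[OF aQ(2)] by (simp add: Spec_simps)
      then have sP: "s P = hat A a P" using aQ(3) by simp
      let ?N = "{Q \<in> V. s Q = restrict (hat A a) V Q}"
      have "openin (base_space (Spec A)) ?N"
        using sections_agree_open[OF Spec_local_homeomorphism V s res[OF aQ(1) V]] by blast
      then show "\<exists>a\<in>carrier A. \<exists>N. openin (base_space (Spec A)) N \<and> P \<in> N \<and> N \<subseteq> V \<and> (\<forall>Q\<in>N. s Q = hat A a Q)"
        using P sP aQ(1) by (intro bexI[of _ a] exI[of _ ?N]) auto
    qed
  next
    assume s: "s \<in> extensional V \<and> ?loc s"
    show "s \<in> sections (Spec A) V"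
    proof (rule sections_local[OF V])
      show "s \<in> extensional V" using s by blast
      fix P assume "P \<in> V"
      then obtain a N where N: "a \<in> carrier A" "openin (base_space (Spec A)) N" "P \<in> N" "N \<subseteq> V"
        "\<forall>Q\<in>N. s Q = hat A a Q" using s by blast
      then show "\<exists>N t. openin (base_space (Spec A)) N \<and> P \<in> N \<and> t \<in> sections (Spec A) N \<and> (\<forall>y\<in>N \<inter> V. s y = t y)"
        using res[OF N(1,2,4)] by (intro exI[of _ N] exI[of _ "restrict (hat A a) N"]) auto
    qed
  }
qed

theorem Spec_mv_space: "mv_space (Spec A)"
  unfolding mv_space_def
proof (intro conjI ballI allI impI)
  show "local_homeomorphism (total_space (Spec A)) (base_space (Spec A)) (proj (Spec A))"
    by (rule Spec_local_homeomorphism)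
next
  fix P assume "P \<in> pts (Spec A)"
  then have P: "P \<in> primes A" by (simp add: pts_Spec)
  then show "carrier (stalk (Spec A) P) = {e \<in> topspace (total_space (Spec A)). proj (Spec A) e = P}"
    by (auto simp: Spec_simps carrier_tagged_quot topspace_Spec_total fst_hat)
  show "mv_chain (stalk (Spec A) P)" using tagged_quot_chain[OF P] by (simp add: Spec_simps)
next
  fix V assume V: "openin (base_space (Spec A)) V"
  have pV: "V \<subseteq> primes A" using openin_subset[OF V] by (simp add: pts_Spec)
  note secV = sections_Spec[OF V]
  have zero: "(\<lambda>P\<in>V. mzero (tagged_quot A P)) \<in> sections (Spec A) V"
    unfolding secV using V pV hat_simps(3) zero_closed by (auto intro!: bexI[of _ \<zero>] exI[of _ V])
  have neg: "(\<lambda>P\<in>V. mneg (tagged_quot A P) (s P)) \<in> sections (Spec A) V" if s: "s \<in> sections (Spec A) V" for s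
    unfolding secV
  proof (intro conjI ballI)
    fix P assume "P \<in> V"
    then obtain a N where N: "a \<in> carrier A" "openin (base_space (Spec A)) N" "P \<in> N" "N \<subseteq> V"
      "\<forall>Q\<in>N. s Q = hat A a Q" using s unfolding secV by blast
    then show "\<exists>a\<in>carrier A. \<exists>N. openin (base_space (Spec A)) N \<and> P \<in> N \<and> N \<subseteq> V \<and>
        (\<forall>Q\<in>N. (\<lambda>P\<in>V. mneg (tagged_quot A P) (s P)) Q = hat A a Q)"
      using pV by (intro bexI[of _ "\<sim> a"] exI[of _ N]) (auto simp: hat_simps subset_iff closed)
  qed simp
  have plus: "(\<lambda>P\<in>V. mplus (tagged_quot A P) (s P) (t P)) \<in> sections (Spec A) V"
    if s: "s \<in> sections (Spec A) V" and t: "t \<in> sections (Spec A) V" for s t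
    unfolding secV
  proof (intro conjI ballI)
    fix P assume "P \<in> V"
    obtain a N where N: "a \<in> carrier A" "openin (base_space (Spec A)) N" "P \<in> N" "N \<subseteq> V"
      "\<forall>Q\<in>N. s Q = hat A a Q" using s \<open>P \<in> V\<close> unfolding secV by blast
    obtain b M where M: "b \<in> carrier A" "openin (base_space (Spec A)) M" "P \<in> M" "M \<subseteq> V"
      "\<forall>Q\<in>M. t Q = hat A b Q" using t \<open>P \<in> V\<close> unfolding secV by blast
    show "\<exists>a\<in>carrier A. \<exists>N. openin (base_space (Spec A)) N \<and> P \<in> N \<and> N \<subseteq> V \<and>
        (\<forall>Q\<in>N. (\<lambda>P\<in>V. mplus (tagged_quot A P) (s P) (t P)) Q = hat A a Q)"
      using N M pV
      by (intro bexI[of _ "a \<oplus> b"] exI[of _ "N \<inter> M"]) (auto simp: hat_simps subset_iff closed)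
  qed simp
  have "s P \<in> carrier (tagged_quot A P)" if "s \<in> sections (Spec A) V" "P \<in> V" for s P
    using that pV unfolding secV by (force simp: carrier_tagged_quot subset_iff)
  then have "sections (Spec A) V \<subseteq> carrier (mv_prod V (stalk (Spec A)))"
    by (auto simp: mv_prod_def Spec_simps PiE_def dest: sectionsD(1))
  then show "mv_subalgebra (sections (Spec A) V) (mv_prod V (stalk (Spec A)))"
    using zero neg plus by (simp add: mv_subalgebra_def mv_prod_def Spec_simps)
qed

end

section \<open>The functor Spec\<close>

lemma mvs_hom_iff:
  "m \<in> mvs_hom X Y \<longleftrightarrow>
     fst m \<in> extensional (pts X) \<and> continuous_map (base_space X) (base_space Y) (fst m) \<and>
     snd m \<in> extensional (pts X) \<and>
     (\<forall>x\<in>pts X. snd m x \<in> mv_hom (stalk Y (fst m x)) (stalk X x)) \<and>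
     (\<forall>V s. openin (base_space Y) V \<longrightarrow> s \<in> sections Y V \<longrightarrow>
        (\<lambda>x\<in>{x \<in> pts X. fst m x \<in> V}. snd m x (s (fst m x))) \<in> sections X {x \<in> pts X. fst m x \<in> V})"
  by (cases m) (auto simp: mvs_hom_def)

lemma mvs_comp_simps:
  "fst (mvs_comp X Z n m) = compose (pts X) (fst n) (fst m)"
  "snd (mvs_comp X Z n m) =
    (\<lambda>x\<in>pts X. mv_comp (stalk Z (fst n (fst m x))) (snd m x) (snd n (fst m x)))"
  by (simp_all add: mvs_comp_def split_beta)

lemma fst_Spec_map: "fst (Spec_map A B h) = (\<lambda>Q\<in>primes B. {a \<in> carrier A. h a \<in> Q})"
  by (simp add: Spec_map_def Let_def)

lemma Spec_map_prime:
  assumes "mv_algebra A" "mv_algebra B" "h \<in> mv_hom A B" "Q \<in> primes B"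
  shows "{a \<in> carrier A. h a \<in> Q} \<in> primes A" "fst (Spec_map A B h) Q = {a \<in> carrier A. h a \<in> Q}"
  using mv_algebra.prime_preimage[OF assms(1,3,2)] assms(4) by (auto simp: primes_def fst_Spec_map)

text \<open>The stalk maps are determined by their values on the classes of elements of \<open>A\<close>, where they act as
  \<open>h\<close>. The later identities between morphisms of spectra are checked on these values.\<close>

lemma Spec_map_hat:
  assumes A: "mv_algebra A" and B: "mv_algebra B" and h: "h \<in> mv_hom A B"
    and Q: "Q \<in> primes B" and a: "a \<in> carrier A"
  shows "snd (Spec_map A B h) Q (hat A a (fst (Spec_map A B h) Q)) = hat B (h a) Q"
proof -
  interpret A: mv_algebra A by fact
  interpret B: mv_algebra B by fact
  define P where "P = {a \<in> carrier A. h a \<in> Q}"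
  have P: "P \<in> primes A" "fst (Spec_map A B h) Q = P"
    using Spec_map_prime[OF A B h Q] by (simp_all add: P_def)
  have hat: "hat A a P = (P, mv_cong A P `` {a})" using P by (simp add: hat_def)
  have "mv_cong B Q `` {h x} = mv_cong B Q `` {h a}" if "x \<in> mv_cong A P `` {a}" for x
  proof -
    have x: "x \<in> carrier A" "mdist A a x \<in> P" using that by (auto simp: mv_cong_def)
    then have "mdist B (h x) (h a) \<in> Q"
      using A.hom_dist[OF h x(1) a] A.dist_commute[OF a x(1)] by (simp add: P_def)
    then show ?thesis
      using B.class_eq_iff[OF B.primes_ideal[OF Q]] mv_homD(2)[OF h] x a by blast
  qed
  moreover have "a \<in> mv_cong A P `` {a}"
    using equiv_class_self[OF A.equiv_cong[OF A.primes_ideal[OF P(1)]] a] .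
  ultimately have "(\<Union>x\<in>mv_cong A P `` {a}. mv_cong B Q `` {h x}) = mv_cong B Q `` {h a}" by blast
  moreover have "hat A a P \<in> carrier (tagged_quot A P)" using A.carrier_tagged_quot[OF P(1)] a by blast
  ultimately show ?thesis
    using Q by (simp add: P(2)) (simp add: Spec_map_def Let_def P_def[symmetric] hat, simp add: hat_def)
qed

theorem Spec_map_hom:
  assumes A: "mv_algebra A" and B: "mv_algebra B" and h: "h \<in> mv_hom A B"
  shows "Spec_map A B h \<in> mvs_hom (Spec B) (Spec A)"
proof -
  interpret A: mv_algebra A by fact
  interpret B: mv_algebra B by fact
  let ?m = "Spec_map A B h"
  note pt = Spec_map_prime[OF A B h]
  note val = Spec_map_hat[OF A B h]
  have fP: "fst ?m Q \<in> primes A" if "Q \<in> primes B" for Q using pt[OF that] by simp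
  have in_W: "fst ?m Q \<in> W A a \<longleftrightarrow> Q \<in> W B (h a)" if "Q \<in> primes B" "a \<in> carrier A" for Q a
    using pt[OF that(1)] that by (simp add: W_def)
  have cont: "continuous_map (base_space (Spec B)) (base_space (Spec A)) (fst ?m)"
    unfolding continuous_map_def
  proof (intro conjI allI impI funcsetI)
    show "fst ?m Q \<in> pts (Spec A)" if "Q \<in> pts (Spec B)" for Q
      using fP that by (simp add: A.pts_Spec B.pts_Spec)
    fix V assume V: "openin (base_space (Spec A)) V"
    show "openin (base_space (Spec B)) {Q \<in> pts (Spec B). fst ?m Q \<in> V}"
      unfolding B.openin_Spec B.pts_Spec
    proof safe
      fix Q assume Q: "Q \<in> primes B" "fst ?m Q \<in> V"
      then obtain a where a: "a \<in> carrier A" "fst ?m Q \<in> W A a" "W A a \<subseteq> V"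
        using V unfolding A.openin_Spec by meson
      moreover have "W B (h a) \<subseteq> {Q \<in> primes B. fst ?m Q \<in> V}"
        using a in_W B.W_subset by blast
      ultimately show "\<exists>b\<in>carrier B. Q \<in> W B b \<and> W B b \<subseteq> {Q \<in> primes B. fst ?m Q \<in> V}"
        using Q in_W mv_homD(2)[OF h] by blast
    qed
  qed
  have hom: "snd ?m Q \<in> mv_hom (tagged_quot A (fst ?m Q)) (tagged_quot B Q)" if Q: "Q \<in> primes B" for Q
  proof (rule mv_homI)
    note cA = A.carrier_tagged_quot[OF fP[OF Q]]
    note simps = A.hat_simps[OF fP[OF Q]] B.hat_simps[OF Q] val[OF Q] mv_homD[OF h] A.closed
    show "snd ?m Q \<in> extensional (carrier (tagged_quot A (fst ?m Q)))"
      using Q pt(2)[OF Q] by (simp add: Spec_map_def Let_def)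
    fix u assume "u \<in> carrier (tagged_quot A (fst ?m Q))"
    then obtain a where a: "a \<in> carrier A" "u = hat A a (fst ?m Q)" unfolding cA by blast
    then show "snd ?m Q u \<in> carrier (tagged_quot B Q)"
      using mv_homD(2)[OF h] by (simp add: simps B.carrier_tagged_quot[OF Q])
    show "snd ?m Q (mneg (tagged_quot A (fst ?m Q)) u) = mneg (tagged_quot B Q) (snd ?m Q u)"
      using a by (simp add: simps)
    fix v assume "v \<in> carrier (tagged_quot A (fst ?m Q))"
    then obtain b where "b \<in> carrier A" "v = hat A b (fst ?m Q)" unfolding cA by blast
    then show "snd ?m Q (mplus (tagged_quot A (fst ?m Q)) u v) =
        mplus (tagged_quot B Q) (snd ?m Q u) (snd ?m Q v)"
      using a by (simp add: simps)
  next
    show "snd ?m Q (mzero (tagged_quot A (fst ?m Q))) = mzero (tagged_quot B Q)"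
      using A.hat_simps(3)[OF fP[OF Q]] B.hat_simps(3)[OF Q] val[OF Q] mv_homD(5)[OF h]
      by (simp add: A.closed)
  qed
  have sec: "(\<lambda>Q\<in>{Q \<in> pts (Spec B). fst ?m Q \<in> V}. snd ?m Q (s (fst ?m Q)))
      \<in> sections (Spec B) {Q \<in> pts (Spec B). fst ?m Q \<in> V}"
    if V: "openin (base_space (Spec A)) V" and s: "s \<in> sections (Spec A) V" for V s
  proof -
    have pre: "openin (base_space (Spec B)) {Q \<in> pts (Spec B). fst ?m Q \<in> N}"
      if "openin (base_space (Spec A)) N" for N
      using cont that by (simp add: continuous_map_def)
    show ?thesis
      unfolding B.sections_Spec[OF pre[OF V]]
    proof (intro conjI ballI)
      fix Q assume Q: "Q \<in> {Q \<in> pts (Spec B). fst ?m Q \<in> V}"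
      then have "fst ?m Q \<in> V" by simp
      then obtain a N where N: "a \<in> carrier A" "openin (base_space (Spec A)) N" "fst ?m Q \<in> N" "N \<subseteq> V"
        "\<forall>P\<in>N. s P = hat A a P" using s unfolding A.sections_Spec[OF V] by blast
      show "\<exists>b\<in>carrier B. \<exists>N. openin (base_space (Spec B)) N \<and> Q \<in> N \<and> N \<subseteq> {Q \<in> pts (Spec B). fst ?m Q \<in> V} \<and>
        (\<forall>R\<in>N. (\<lambda>Q\<in>{Q \<in> pts (Spec B). fst ?m Q \<in> V}. snd ?m Q (s (fst ?m Q))) R = hat B b R)"
        using N Q pre[OF N(2)] mv_homD(2)[OF h N(1)] val
        by (intro bexI[of _ "h a"] exI[of _ "{Q \<in> pts (Spec B). fst ?m Q \<in> N}"])
          (auto simp: B.pts_Spec)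
    qed simp
  qed
  have ext: "fst ?m \<in> extensional (primes B)" "snd ?m \<in> extensional (primes B)"
    by (simp_all add: Spec_map_def Let_def)
  show ?thesis
    unfolding mvs_hom_iff using ext cont hom sec by (simp add: B.pts_Spec Spec_simps)
qed

theorem Spec_map_id:
  assumes A: "mv_algebra A"
  shows "Spec_map A A (mv_id A) = mvs_id (Spec A)"
proof (rule prod_eqI)
  interpret mv_algebra A by fact
  note id = mv_id_hom[OF A]
  let ?m = "Spec_map A A (mv_id A)"
  have m: "?m \<in> mvs_hom (Spec A) (Spec A)" by (rule Spec_map_hom[OF A A id])
  have pt: "fst ?m P = P" if "P \<in> primes A" for P
    using Spec_map_prime(2)[OF A A id that] idealD(1)[OF primes_ideal[OF that]] by (auto simp: mv_id_def)
  show "fst ?m = fst (mvs_id (Spec A))"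
    by (rule extensionalityI[of _ "primes A"]) (use m pt in \<open>auto simp: mvs_id_def pts_Spec mvs_hom_iff\<close>)
  have "snd ?m P = mv_id (tagged_quot A P)" if P: "P \<in> primes A" for P
  proof (rule extensionalityI[of _ "carrier (tagged_quot A P)"])
    show "snd ?m P \<in> extensional (carrier (tagged_quot A P))"
      using m P pt[OF P] mv_homD(1) by (force simp: mvs_hom_iff pts_Spec Spec_simps)
    fix u assume "u \<in> carrier (tagged_quot A P)"
    then obtain a where "a \<in> carrier A" "u = hat A a P" unfolding carrier_tagged_quot[OF P] by blast
    then show "snd ?m P u = mv_id (tagged_quot A P) u"
      using Spec_map_hat[OF A A id P] pt[OF P] carrier_tagged_quot[OF P] by (simp add: mv_id_def)
  qed (simp add: mv_id_def)
  then show "snd ?m = snd (mvs_id (Spec A))"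
    by (intro extensionalityI[of _ "primes A"])
      (use m in \<open>auto simp: mvs_id_def pts_Spec mvs_hom_iff Spec_simps\<close>)
qed

theorem Spec_map_comp:
  assumes A: "mv_algebra A" and B: "mv_algebra B" and C: "mv_algebra C"
    and h: "h \<in> mv_hom A B" and k: "k \<in> mv_hom B C"
  shows "Spec_map A C (mv_comp A k h) =
    mvs_comp (Spec C) (Spec A) (Spec_map A B h) (Spec_map B C k)"
proof (rule prod_eqI)
  interpret A: mv_algebra A by fact
  interpret C: mv_algebra C by fact
  note kh = mv_hom_comp[OF A h k]
  let ?m = "Spec_map A C (mv_comp A k h)" and ?f = "Spec_map A B h" and ?g = "Spec_map B C k"
  have m: "?m \<in> mvs_hom (Spec C) (Spec A)" by (rule Spec_map_hom[OF A C kh])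
  have g: "fst ?g R \<in> primes B" if "R \<in> primes C" for R
    using Spec_map_prime[OF B C k that] by simp
  have pt: "fst ?m R = fst ?f (fst ?g R)" if R: "R \<in> primes C" for R
    using Spec_map_prime(2)[OF A C kh R] Spec_map_prime(2)[OF B C k R] Spec_map_prime(2)[OF A B h g[OF R]]
      mv_homD(2)[OF h] by (auto simp: mv_comp_def compose_def)
  show "fst ?m = fst (mvs_comp (Spec C) (Spec A) ?f ?g)"
    by (rule extensionalityI[of _ "primes C"])
      (use m pt in \<open>auto simp: mvs_comp_simps C.pts_Spec mvs_hom_iff compose_def\<close>)
  have "snd ?m R = mv_comp (tagged_quot A (fst ?f (fst ?g R))) (snd ?g R) (snd ?f (fst ?g R))"
    if R: "R \<in> primes C" for R
  proof (rule extensionalityI[of _ "carrier (tagged_quot A (fst ?m R))"])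
    show "snd ?m R \<in> extensional (carrier (tagged_quot A (fst ?m R)))"
      using m R mv_homD(1) by (force simp: mvs_hom_iff C.pts_Spec Spec_simps)
    show "mv_comp (tagged_quot A (fst ?f (fst ?g R))) (snd ?g R) (snd ?f (fst ?g R))
        \<in> extensional (carrier (tagged_quot A (fst ?m R)))"
      unfolding pt[OF R] by (simp add: mv_comp_def compose_def)
    have P: "fst ?m R \<in> primes A" using Spec_map_prime[OF A C kh R] by simp
    fix u assume u: "u \<in> carrier (tagged_quot A (fst ?m R))"
    then obtain a where a: "a \<in> carrier A" "u = hat A a (fst ?m R)"
      unfolding A.carrier_tagged_quot[OF P] by blast
    have "snd ?m R u = hat C (k (h a)) R"
      using Spec_map_hat[OF A C kh R a(1)] a by (simp add: mv_comp_def compose_def)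
    moreover have "snd ?f (fst ?g R) u = hat B (h a) (fst ?g R)"
      using Spec_map_hat[OF A B h g[OF R] a(1)] a(2) pt[OF R] by simp
    moreover have "snd ?g R (hat B (h a) (fst ?g R)) = hat C (k (h a)) R"
      by (rule Spec_map_hat[OF B C k R mv_homD(2)[OF h a(1)]])
    ultimately show "snd ?m R u =
        mv_comp (tagged_quot A (fst ?f (fst ?g R))) (snd ?g R) (snd ?f (fst ?g R)) u"
      using u pt[OF R] by (simp add: mv_comp_def compose_def)
  qed
  then show "snd ?m = snd (mvs_comp (Spec C) (Spec A) ?f ?g)"
    by (intro extensionalityI[of _ "primes C"])
      (use m in \<open>auto simp: mvs_comp_simps C.pts_Spec mvs_hom_iff Spec_simps\<close>)
qed

section \<open>The functor of global sections\<close>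

lemma mv_spaceD:
  assumes "mv_space X"
  shows "local_homeomorphism (total_space X) (base_space X) (proj X)"
    "x \<in> pts X \<Longrightarrow> carrier (stalk X x) = {e \<in> topspace (total_space X). proj X e = x}"
    "x \<in> pts X \<Longrightarrow> mv_chain (stalk X x)" "x \<in> pts X \<Longrightarrow> mv_algebra (stalk X x)"
    "openin (base_space X) U \<Longrightarrow> mv_subalgebra (sections X U) (mv_prod U (stalk X))"
  using assms by (auto simp: mv_space_def mv_chain_def)

lemma Gam_simps:
  "carrier (Gam X) = sections X (pts X)"
  "mplus (Gam X) s t = (\<lambda>x\<in>pts X. mplus (stalk X x) (s x) (t x))"
  "mneg (Gam X) s = (\<lambda>x\<in>pts X. mneg (stalk X x) (s x))"
  "mzero (Gam X) = (\<lambda>x\<in>pts X. mzero (stalk X x))"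
  by (simp_all add: Gam_def mv_prod_def)

lemma section_value:
  assumes "mv_space X" "s \<in> sections X U" "x \<in> U" "x \<in> pts X"
  shows "s x \<in> carrier (stalk X x)"
  using mv_spaceD(2)[OF assms(1,4)] sectionsD(2,3)[OF assms(2,3)] assms(4) by simp

theorem Gam_algebra:
  assumes "mv_space X"
  shows "mv_algebra (Gam X)"
  unfolding Gam_def using mv_spaceD(4,5)[OF assms] by (intro subalgebra_prod_algebra) auto

lemma Gam_eval_hom:
  assumes "mv_space X" "x \<in> pts X"
  shows "(\<lambda>s\<in>carrier (Gam X). s x) \<in> mv_hom (Gam X) (stalk X x)"
  using assms mv_algebra.closed(1-3)[OF Gam_algebra[OF assms(1)]] section_value[OF assms(1)]
  by (intro mv_homI) (auto simp: Gam_simps)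

theorem Gam_map_hom:
  assumes X: "mv_space X" and Y: "mv_space Y" and m: "m \<in> mvs_hom X Y"
  shows "Gam_map X Y m \<in> mv_hom (Gam Y) (Gam X)"
proof -
  have f: "fst m x \<in> pts Y" if "x \<in> pts X" for x
    using m that by (auto simp: mvs_hom_iff continuous_map_def)
  then have pre: "{x \<in> pts X. fst m x \<in> pts Y} = pts X" by blast
  have sec: "(\<lambda>x\<in>pts X. snd m x (s (fst m x))) \<in> sections X (pts X)" if "s \<in> sections Y (pts Y)" for s
  proof -
    have "(\<lambda>x\<in>{x \<in> pts X. fst m x \<in> pts Y}. snd m x (s (fst m x)))
        \<in> sections X {x \<in> pts X. fst m x \<in> pts Y}"
      using m that openin_topspace[of "base_space Y"] unfolding mvs_hom_iff by blast
    then show ?thesis by (simp only: pre)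
  qed
  have hom: "snd m x \<in> mv_hom (stalk Y (fst m x)) (stalk X x)" if "x \<in> pts X" for x
    using m that by (simp add: mvs_hom_iff)
  have closed: "mplus (Gam Y) s t \<in> sections Y (pts Y)" "mneg (Gam Y) s \<in> sections Y (pts Y)"
      "mzero (Gam Y) \<in> sections Y (pts Y)"
    if "s \<in> sections Y (pts Y)" "t \<in> sections Y (pts Y)" for s t
    using mv_algebra.closed(1-3)[OF Gam_algebra[OF Y]] that by (simp_all add: Gam_simps(1))
  have "mzero (Gam Y) \<in> sections Y (pts Y)"
    using mv_algebra.closed(3)[OF Gam_algebra[OF Y]] by (simp add: Gam_simps(1))
  then show ?thesis
    using closed sec section_value[OF Y] f mv_homD[OF hom]
    by (intro mv_homI) (auto simp: Gam_map_def split_beta Gam_simps intro!: restrict_ext)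
qed

theorem Gam_map_id:
  assumes X: "mv_space X"
  shows "Gam_map X X (mvs_id X) = mv_id (Gam X)"
proof -
  have "(\<lambda>x\<in>pts X. mv_id (stalk X x) (s x)) = s" if "s \<in> sections X (pts X)" for s
    using section_value[OF X that] sectionsD(1)[OF that]
    by (intro extensionalityI[of _ "pts X"]) (auto simp: mv_id_def)
  then show ?thesis
    by (auto simp: Gam_map_def mvs_id_def mv_id_def[of "Gam X"] Gam_simps(1) intro!: restrict_ext cong: restrict_cong)
qed

theorem Gam_map_comp:
  assumes X: "mv_space X" and Y: "mv_space Y" and Z: "mv_space Z"
    and m: "m \<in> mvs_hom X Y" and n: "n \<in> mvs_hom Y Z"
  shows "Gam_map X Z (mvs_comp X Z n m) = mv_comp (Gam Z) (Gam_map X Y m) (Gam_map Y Z n)"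
proof (rule extensionalityI[of _ "carrier (Gam Z)"])
  fix s assume s: "s \<in> carrier (Gam Z)"
  have f: "fst m x \<in> pts Y" if "x \<in> pts X" for x
    using m that by (auto simp: mvs_hom_iff continuous_map_def)
  have g: "fst n y \<in> pts Z" if "y \<in> pts Y" for y
    using n that by (auto simp: mvs_hom_iff continuous_map_def)
  have val: "s (fst n (fst m x)) \<in> carrier (stalk Z (fst n (fst m x)))" if "x \<in> pts X" for x
    using section_value[OF Z] s f g that by (simp add: Gam_simps)
  have "Gam_map Y Z n s \<in> carrier (Gam Y)" using mv_homD(2)[OF Gam_map_hom[OF Y Z n] s] .
  then show "Gam_map X Z (mvs_comp X Z n m) s = mv_comp (Gam Z) (Gam_map X Y m) (Gam_map Y Z n) s"
    using s f val
    by (auto simp: mv_comp_def[of "Gam Z"] compose_def[of "carrier (Gam Z)"] Gam_map_def split_beta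
      mvs_comp_simps compose_def[of "pts X"] intro!: restrict_ext) (simp add: mv_comp_def compose_def)
qed (auto simp: Gam_map_def mv_comp_def compose_def split_beta)

section \<open>The spectrum of a hyperarchimedean algebra\<close>

text \<open>The basic open sets of the spectrum are closed under complements; this is what makes the spectrum a
  Stone space.\<close>

lemma W_complement:
  assumes A: "hyperarchimedean A" and a: "a \<in> carrier A"
  obtains c where "c \<in> carrier A" "W A c = primes A - W A a"
proof -
  interpret mv_algebra A using A by (rule hyperarchimedean_algebra)
  obtain e where e: "e \<in> carrier A" "\<And>P. mv_prime A P \<Longrightarrow> mneg A e \<in> P \<longleftrightarrow> a \<notin> P"
    using hyperarchimedean_boolean[OF A a] by metis
  then have "W A (mneg A e) = primes A - W A a" by (auto simp: W_def primes_def)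
  then show ?thesis using that e closed(2) by blast
qed

text \<open>The elements that lie in every prime outside some finite part of a given cover form an ideal.
  A prime above that ideal would have to miss every member of the cover, because each basic open set
  is the complement of another one; so the ideal is improper and contains \<open>1\<close>.\<close>

lemma Spec_compact:
  assumes A: "hyperarchimedean A"
  shows "compact_space (base_space (Spec A))"
  unfolding compact_space_alt
proof (intro allI impI, elim conjE)
  interpret mv_algebra A using A by (rule hyperarchimedean_algebra)
  fix \<U> assume op: "\<forall>U\<in>\<U>. openin (base_space (Spec A)) U" and cov: "pts (Spec A) \<subseteq> \<Union>\<U>"
  define off where "off \<V> = {x \<in> carrier A. \<forall>P\<in>primes A. P \<notin> \<Union>\<V> \<longrightarrow> x \<in> P}" for \<V>
  define I where "I = {x. \<exists>\<V>. finite \<V> \<and> \<V> \<subseteq> \<U> \<and> x \<in> off \<V>}"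
  have "x \<oplus>\<^bsub>A\<^esub> y \<in> I" if xy: "x \<in> I" "y \<in> I" for x y
  proof -
    obtain \<V> \<V>' where V: "finite \<V>" "\<V> \<subseteq> \<U>" "x \<in> off \<V>" "finite \<V>'" "\<V>' \<subseteq> \<U>" "y \<in> off \<V>'"
      using xy unfolding I_def by blast
    then have "x \<oplus>\<^bsub>A\<^esub> y \<in> off (\<V> \<union> \<V>')"
      using idealD(4)[OF primes_ideal] closed(1) by (simp add: off_def)
    then show ?thesis
      unfolding I_def using V(1,2,4,5) by (intro CollectI exI[of _ "\<V> \<union> \<V>'"]) simp
  qed
  moreover have "x \<in> I" if xy: "x \<in> carrier A" "y \<in> I" "mle A x y" for x y
  proof -
    obtain \<V> where V: "finite \<V>" "\<V> \<subseteq> \<U>" "y \<in> off \<V>" using xy(2) unfolding I_def by blast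
    have "x \<in> off \<V>" using V(3) xy(1) idealD(3)[OF primes_ideal xy(1) _ xy(3)] by (simp add: off_def)
    then show ?thesis unfolding I_def using V(1,2) by blast
  qed
  moreover have "mzero A \<in> off {}" using idealD(2)[OF primes_ideal] zero_closed by (simp add: off_def)
  then have "mzero A \<in> I" unfolding I_def by blast
  moreover have "I \<subseteq> carrier A" by (auto simp: I_def off_def)
  ultimately have I: "mv_ideal A I" unfolding mv_ideal_def by blast
  have "mone A \<in> I"
  proof (rule ccontr)
    assume "mone A \<notin> I"
    then obtain P where P: "mv_prime A P" "I \<subseteq> P" using prime_separation[OF I one_closed] by metis
    then have "P \<in> \<Union>\<U>" using cov by (auto simp: pts_Spec primes_def)
    then obtain U where U: "U \<in> \<U>" "P \<in> U" by blast
    then obtain a where a: "a \<in> carrier A" "P \<in> W A a" "W A a \<subseteq> U"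
      using op unfolding openin_Spec by meson
    obtain c where c: "c \<in> carrier A" "W A c = primes A - W A a" using W_complement[OF A a(1)] by metis
    have "primes A - U \<subseteq> W A c" using c(2) a(3) by blast
    then have "c \<in> off {U}" using c(1) by (auto simp: W_def off_def)
    then have "c \<in> I" using U(1) unfolding I_def by (intro CollectI exI[of _ "{U}"]) simp
    then have "P \<in> W A c" using P by (auto simp: W_def primes_def)
    then show False using c(2) a(2) by blast
  qed
  then obtain \<V> where V: "finite \<V>" "\<V> \<subseteq> \<U>" "\<forall>P\<in>primes A. P \<notin> \<Union>\<V> \<longrightarrow> mone A \<in> P"
    unfolding I_def off_def by blast
  moreover have "\<forall>P\<in>primes A. mone A \<notin> P" using primeD(2) by (simp add: primes_def)
  ultimately have "primes A \<subseteq> \<Union>\<V>" by blast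
  then show "\<exists>\<F>. finite \<F> \<and> \<F> \<subseteq> \<U> \<and> pts (Spec A) \<subseteq> \<Union>\<F>" using V by (auto simp: pts_Spec)
qed

lemma Spec_Hausdorff:
  assumes A: "hyperarchimedean A"
  shows "Hausdorff_space (base_space (Spec A))"
  unfolding Hausdorff_space_def
proof (intro allI impI, elim conjE)
  interpret mv_algebra A using A by (rule hyperarchimedean_algebra)
  have sep: "\<exists>U V. openin (base_space (Spec A)) U \<and> openin (base_space (Spec A)) V \<and> P \<in> U \<and> Q \<in> V \<and> disjnt U V"
    if PQ: "P \<in> primes A" "Q \<in> primes A" "a \<in> P" "a \<notin> Q" for P Q a
  proof -
    have a: "a \<in> carrier A" using PQ idealD(1)[OF primes_ideal] by blast
    obtain c where c: "c \<in> carrier A" "W A c = primes A - W A a" using W_complement[OF A a] by metis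
    then have "P \<in> W A a" "Q \<in> W A c" "disjnt (W A a) (W A c)" using PQ by (auto simp: W_def disjnt_def)
    then show ?thesis using W_open[OF a] W_open[OF c(1)] by blast
  qed
  fix P Q assume "P \<in> pts (Spec A)" "Q \<in> pts (Spec A)" "P \<noteq> Q"
  then have PQ: "P \<in> primes A" "Q \<in> primes A" and "(\<exists>a. a \<in> P \<and> a \<notin> Q) \<or> (\<exists>a. a \<in> Q \<and> a \<notin> P)"
    by (auto simp: pts_Spec)
  then show "\<exists>U V. openin (base_space (Spec A)) U \<and> openin (base_space (Spec A)) V \<and> P \<in> U \<and> Q \<in> V \<and> disjnt U V"
    using sep[OF PQ] sep[OF PQ(2,1)] disjnt_sym by meson
qed

lemma Spec_stone:
  assumes A: "hyperarchimedean A"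
  shows "stone_space (base_space (Spec A))"
proof -
  interpret mv_algebra A using A by (rule hyperarchimedean_algebra)
  have clopen: "closedin (base_space (Spec A)) (W A a)" if a: "a \<in> carrier A" for a
  proof -
    obtain c where "c \<in> carrier A" "W A c = primes A - W A a" using W_complement[OF A a] by metis
    then show ?thesis using W_open[of c] W_subset by (simp add: closedin_def pts_Spec)
  qed
  have "openin (base_space (Spec A)) = arbitrary union_of
      (\<lambda>U. openin (base_space (Spec A)) U \<and> closedin (base_space (Spec A)) U)"
    unfolding openin_topology_base_unique
  proof (intro conjI allI impI, blast, elim conjE)
    fix U P assume "openin (base_space (Spec A)) U" "P \<in> U"
    then obtain a where "a \<in> carrier A" "P \<in> W A a" "W A a \<subseteq> U" unfolding openin_Spec by meson
    then show "\<exists>V. (openin (base_space (Spec A)) V \<and> closedin (base_space (Spec A)) V) \<and> P \<in> V \<and> V \<subseteq> U"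
      using W_open clopen by blast
  qed
  then show ?thesis using Spec_compact[OF A] Spec_Hausdorff[OF A] by (simp add: stone_space_def)
qed

text \<open>Points in different fibres are separated by pulling back from the base. Two classes \<open>[a]\<close> and
  \<open>[b]\<close> in the fibre of \<open>P\<close> differ on the whole complement of \<open>W (d a b)\<close>, which is open.\<close>

lemma Spec_total_Hausdorff:
  assumes A: "hyperarchimedean A"
  shows "Hausdorff_space (total_space (Spec A))"
  unfolding Hausdorff_space_def
proof (intro allI impI, elim conjE)
  interpret mv_algebra A using A by (rule hyperarchimedean_algebra)
  fix u v assume "u \<in> topspace (total_space (Spec A))" "v \<in> topspace (total_space (Spec A))" and uv: "u \<noteq> v"
  then obtain a P b Q where u: "u = hat A a P" "a \<in> carrier A" "P \<in> primes A"
    and v: "v = hat A b Q" "b \<in> carrier A" "Q \<in> primes A"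
    unfolding topspace_Spec_total by blast
  have "\<exists>U V. openin (base_space (Spec A)) U \<and> openin (base_space (Spec A)) V \<and> P \<in> U \<and> Q \<in> V \<and>
      disjnt (hat A a ` U) (hat A b ` V)"
  proof (cases "P = Q")
    case False
    then obtain U V where UV: "openin (base_space (Spec A)) U" "openin (base_space (Spec A)) V"
      "P \<in> U" "Q \<in> V" "disjnt U V"
      using Spec_Hausdorff[OF A] u(3) v(3) unfolding Hausdorff_space_def pts_Spec by metis
    have "U \<subseteq> primes A" "V \<subseteq> primes A" using openin_subset UV(1,2) pts_Spec by blast+
    then have "disjnt (hat A a ` U) (hat A b ` V)" using UV(5) by (auto simp: disjnt_def hat_def subset_iff)
    then show ?thesis using UV by blast
  next
    case True
    then have d: "mdist A a b \<in> carrier A" "P \<notin> W A (mdist A a b)"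
      using u v uv hat_eq_iff[OF u(3,2) v(2)] by (auto simp: W_def closed)
    obtain c where c: "c \<in> carrier A" "W A c = primes A - W A (mdist A a b)"
      using W_complement[OF A d(1)] by metis
    have "disjnt (hat A a ` W A c) (hat A b ` W A c)"
      unfolding disjnt_iff
    proof (intro allI notI, elim conjE imageE)
      fix e R S assume e: "e = hat A a R" "R \<in> W A c" "e = hat A b S" "S \<in> W A c"
      then have "R \<in> primes A" "S \<in> primes A" using W_subset by blast+
      moreover from this have "R = S" using e by (simp add: hat_def)
      ultimately have "R \<in> W A (mdist A a b)"
        using hat_eq_iff[of R a b] u(2) v(2) e by (simp add: W_def)
      then show False using e(2) c(2) by blast
    qed
    then show ?thesis using True c d u(3) W_open[OF c(1)] by blast
  qed
  then obtain U V where "openin (base_space (Spec A)) U" "openin (base_space (Spec A)) V" "P \<in> U" "Q \<in> V"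
      "disjnt (hat A a ` U) (hat A b ` V)" by blast
  then show "\<exists>U V. openin (total_space (Spec A)) U \<and> openin (total_space (Spec A)) V \<and> u \<in> U \<and> v \<in> V \<and> disjnt U V"
    using hat_image_open u v by blast
qed

theorem Spec_stone_simple_space:
  assumes A: "hyperarchimedean A"
  shows "stone_simple_space (Spec A)"
proof -
  interpret mv_algebra A using A by (rule hyperarchimedean_algebra)
  have "\<exists>s\<in>sections (Spec A) (pts (Spec A)). \<exists>P\<in>pts (Spec A). s P = e"
    if "e \<in> topspace (total_space (Spec A))" for e
    using that hat_section unfolding topspace_Spec_total pts_Spec by blast
  moreover have "mv_simple (tagged_quot A P)" if P: "P \<in> primes A" for P
    using hyperarchimedean_image[OF A hat_hom[OF P]] tagged_quot_chain[OF P]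
    by (intro hyperarchimedean_chain_simple) (simp_all add: carrier_tagged_quot[OF P])
  ultimately show ?thesis
    using Spec_mv_space Spec_stone[OF A] Spec_total_Hausdorff[OF A]
    by (simp add: stone_simple_space_def global_sheaf_def hausdorff_sheaf_def pts_Spec Spec_simps)
qed

section \<open>A hyperarchimedean algebra is the algebra of global sections of its spectrum\<close>

lemma mv_iso_bij:
  assumes A: "mv_algebra A" and h: "h \<in> mv_hom A B" and bij: "bij_betw h (carrier A) (carrier B)"
  shows "mv_iso A B h"
proof -
  interpret mv_algebra A by fact
  let ?k = "restrict (inv_into (carrier A) h) (carrier B)"
  have k: "?k (h x) = x" if "x \<in> carrier A" for x
    using that bij mv_homD(2)[OF h] by (simp add: bij_betw_inv_into_left)
  have surj: "\<exists>a\<in>carrier A. b = h a" if "b \<in> carrier B" for b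
    using that bij by (auto simp: bij_betw_def)
  have "?k \<in> mv_hom B A"
  proof (rule mv_homI)
    fix x assume "x \<in> carrier B"
    then obtain a where a: "a \<in> carrier A" "x = h a" using surj by blast
    then show "?k x \<in> carrier A" by (simp only: k)
    show "?k (mneg B x) = mneg A (?k x)"
      using a k closed by (simp only: mv_homD(4)[OF h, symmetric])
    fix y assume "y \<in> carrier B"
    then obtain b where "b \<in> carrier A" "y = h b" using surj by blast
    then show "?k (x \<oplus>\<^bsub>B\<^esub> y) = ?k x \<oplus>\<^bsub>A\<^esub> ?k y"
      using a k closed by (simp only: mv_homD(3)[OF h, symmetric])
  next
    show "?k (mzero B) = mzero A" using k closed by (simp only: mv_homD(5)[OF h, symmetric])
  qed simp
  moreover have "mv_comp A ?k h = mv_id A"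
    using k by (auto simp: mv_comp_def mv_id_def compose_def simp del: restrict_apply intro!: restrict_ext)
  moreover have "mv_comp B h ?k = mv_id B"
  proof (rule extensionalityI[of _ "carrier B"])
    fix b assume b: "b \<in> carrier B"
    then show "mv_comp B h ?k b = mv_id B b"
      using bij_betw_inv_into_right[OF bij] by (simp add: mv_comp_def mv_id_def compose_def)
  qed (simp_all add: mv_comp_def mv_id_def compose_def)
  ultimately show ?thesis using h unfolding mv_iso_def by blast
qed

lemma unit_mv_hom:
  assumes "mv_algebra A"
  shows "unit_mv A \<in> mv_hom A (Gam (Spec A))"
proof -
  interpret mv_algebra A by fact
  have eq: "hat A a = (\<lambda>P\<in>primes A. hat A a P)" for a
    by (simp add: hat_def fun_eq_iff)
  show ?thesis
    using hat_section
    by (intro mv_homI)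
      (auto simp: unit_mv_def Gam_simps pts_Spec Spec_simps hat_simps closed eq[symmetric]
        cong: restrict_cong)
qed

text \<open>Over the finitely many basic sets of a cover, a section is patched together one set \<open>W b\<close> at a
  time: with \<open>e\<close> the Boolean element for \<open>b\<close>, the element \<open>(a \<ominus> e) \<oplus> (c \<ominus> \<not> e)\<close> agrees with \<open>a\<close> on \<open>W b\<close>,
  where \<open>e\<close> is \<open>0\<close>, and with \<open>c\<close> off \<open>W b\<close>, where \<open>e\<close> is \<open>1\<close>.\<close>

lemma section_patch:
  assumes A: "hyperarchimedean A" and abc: "a \<in> carrier A" "b \<in> carrier A" "c \<in> carrier A"
  obtains r where "r \<in> carrier A" "\<And>P. P \<in> W A b \<Longrightarrow> hat A r P = hat A a P"
    "\<And>P. P \<in> primes A - W A b \<Longrightarrow> hat A r P = hat A c P"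
proof -
  interpret mv_algebra A using A by (rule hyperarchimedean_algebra)
  obtain e where e: "e \<in> carrier A" "\<And>P. mv_prime A P \<Longrightarrow> e \<in> P \<longleftrightarrow> b \<in> P"
    "\<And>P. mv_prime A P \<Longrightarrow> mneg A e \<in> P \<longleftrightarrow> b \<notin> P"
    using hyperarchimedean_boolean[OF A abc(2)] by metis
  define r where "r = mminus A a e \<oplus>\<^bsub>A\<^esub> mminus A c (mneg A e)"
  have r: "r \<in> carrier A" using abc e by (simp add: r_def closed)
  have val: "hat A r P = (if P \<in> W A b then hat A a P else hat A c P)" if P: "P \<in> primes A" for P
  proof -
    let ?T = "tagged_quot A P"
    interpret T: mv_algebra ?T by (rule tagged_quot_algebra[OF P])
    have car: "hat A x P \<in> carrier ?T" if "x \<in> carrier A" for x using that carrier_tagged_quot[OF P] by blast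
    have minus: "mminus ?T (hat A x P) (hat A y P) = hat A (mminus A x y) P"
      if "x \<in> carrier A" "y \<in> carrier A" for x y
      using hom_minus[OF hat_hom[OF P] that] that by (simp add: closed)
    have "hat A r P = mplus ?T (mminus ?T (hat A a P) (hat A e P))
        (mminus ?T (hat A c P) (mneg ?T (hat A e P)))"
      using abc e by (simp add: r_def minus hat_simps[OF P] closed)
    moreover have "P \<in> W A b \<Longrightarrow> hat A e P = mzero ?T"
      using hat_eq_zero_iff[OF P e(1)] e(2)[of P] P by (simp add: W_def primes_def)
    moreover have "P \<notin> W A b \<Longrightarrow> mneg ?T (hat A e P) = mzero ?T \<and> hat A e P = mone ?T"
      using hat_eq_zero_iff[OF P closed(2)[OF e(1)]] e(3)[of P] P T.neg_neg[OF car[OF e(1)]]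
      by (auto simp: W_def primes_def hat_simps(2)[OF P e(1)] mone_def)
    ultimately show ?thesis
      using car[OF abc(1)] car[OF abc(3)]
      by (auto simp: T.minus_zero T.minus_one T.plus_zero T.zero_plus mone_def[symmetric])
  qed
  show ?thesis
  proof (rule that[OF r])
    show "hat A r P = hat A a P" if "P \<in> W A b" for P
      using val[of P] that W_subset[of b] by auto
    show "hat A r P = hat A c P" if "P \<in> primes A - W A b" for P
      using val[of P] that by simp
  qed
qed

text \<open>Two elements with the same global section have their distance in every prime, so they coincide by
  prime separation. For surjectivity, a section is given by elements of \<open>A\<close> on the members of a cover by
  basic sets; compactness leaves finitely many, and these are patched one after the other.\<close>

theorem unit_mv_iso:
  assumes A: "hyperarchimedean A"
  shows "mv_iso A (Gam (Spec A)) (unit_mv A)"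
proof (rule mv_iso_bij)
  interpret mv_algebra A using A by (rule hyperarchimedean_algebra)
  show "mv_algebra A" by (rule mv_algebra_axioms)
  show "unit_mv A \<in> mv_hom A (Gam (Spec A))" by (rule unit_mv_hom[OF mv_algebra_axioms])
  show "bij_betw (unit_mv A) (carrier A) (carrier (Gam (Spec A)))"
  proof (rule bij_betw_imageI)
    show "inj_on (unit_mv A) (carrier A)"
    proof (rule inj_onI)
      fix x y assume xy: "x \<in> carrier A" "y \<in> carrier A" "unit_mv A x = unit_mv A y"
      have "mdist A x y \<in> P" if "mv_prime A P" for P
        using xy hat_eq_iff[of P x y] that by (simp add: unit_mv_def primes_def)
      then have "mdist A x y = mzero A"
        using prime_separation[OF zero_ideal, of "mdist A x y"] xy by (auto simp: closed)
      then show "x = y" using xy dist_zero_iff by blast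
    qed
    have "s \<in> unit_mv A ` carrier A" if "s \<in> carrier (Gam (Spec A))" for s
    proof -
      have op: "openin (base_space (Spec A)) (primes A)"
        using openin_topspace[of "base_space (Spec A)"] by (simp add: pts_Spec)
      have s: "s \<in> sections (Spec A) (primes A)" using that by (simp add: Gam_simps pts_Spec)
      define \<U> where "\<U> = {W A b | b. b \<in> carrier A \<and> (\<exists>a\<in>carrier A. \<forall>Q\<in>W A b. s Q = hat A a Q)}"
      have "pts (Spec A) \<subseteq> \<Union>\<U>"
      proof
        fix P assume "P \<in> pts (Spec A)"
        then have "P \<in> primes A" by (simp add: pts_Spec)
        then obtain a N where N: "a \<in> carrier A" "openin (base_space (Spec A)) N" "P \<in> N"
          "\<forall>Q\<in>N. s Q = hat A a Q" using s unfolding sections_Spec[OF op] by blast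
        then obtain b where "b \<in> carrier A" "P \<in> W A b" "W A b \<subseteq> N" unfolding openin_Spec by meson
        then show "P \<in> \<Union>\<U>" using N unfolding \<U>_def by blast
      qed
      moreover have "\<forall>U\<in>\<U>. openin (base_space (Spec A)) U" using W_open by (auto simp: \<U>_def)
      ultimately obtain \<V> where V: "finite \<V>" "\<V> \<subseteq> \<U>" "pts (Spec A) \<subseteq> \<Union>\<V>"
        using Spec_compact[OF A] unfolding compact_space_alt by metis
      have "\<exists>c\<in>carrier A. \<forall>Q\<in>\<Union>\<V>. s Q = hat A c Q"
        using V(1,2)
      proof (induction \<V> rule: finite_induct)
        case empty
        then show ?case using zero_closed by blast
      next
        case (insert U \<V>)
        then obtain c where c: "c \<in> carrier A" "\<forall>Q\<in>\<Union>\<V>. s Q = hat A c Q" by blast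
        obtain a b where ab: "U = W A b" "a \<in> carrier A" "b \<in> carrier A" "\<forall>Q\<in>W A b. s Q = hat A a Q"
          using insert.prems unfolding \<U>_def by blast
        have sub: "\<Union>\<V> \<subseteq> primes A" using insert.prems W_subset unfolding \<U>_def by blast
        obtain r where r: "r \<in> carrier A" "\<And>P. P \<in> W A b \<Longrightarrow> hat A r P = hat A a P"
          "\<And>P. P \<in> primes A - W A b \<Longrightarrow> hat A r P = hat A c P"
          using section_patch[OF A ab(2,3) c(1)] by metis
        have "s Q = hat A r Q" if Q: "Q \<in> \<Union>(insert U \<V>)" for Q
        proof (cases "Q \<in> W A b")
          case False
          then have "Q \<in> \<Union>\<V>" using Q ab(1) by blast
          then show ?thesis using False c(2) sub r(3)[of Q] by auto
        qed (use ab(4) r(2) in simp)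
        then show ?case using r(1) by blast
      qed
      then obtain c where c: "c \<in> carrier A" "\<forall>Q\<in>primes A. s Q = hat A c Q"
        using V(3) unfolding pts_Spec by blast
      have "s = hat A c"
        using c(2) sectionsD(1)[OF s] by (intro extensionalityI[of _ "primes A"]) (auto simp: hat_def)
      then show ?thesis using c(1) by (auto simp: unit_mv_def)
    qed
    then show "unit_mv A ` carrier A = carrier (Gam (Spec A))"
      using mv_homD(2)[OF unit_mv_hom[OF mv_algebra_axioms]] by blast
  qed
qed

theorem unit_mv_natural:
  assumes A: "mv_algebra A" and B: "mv_algebra B" and h: "h \<in> mv_hom A B"
  shows "mv_comp A (unit_mv B) h = mv_comp A (Gam_map (Spec B) (Spec A) (Spec_map A B h)) (unit_mv A)"
proof (rule extensionalityI[of _ "carrier A"])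
  interpret A: mv_algebra A by fact
  interpret B: mv_algebra B by fact
  fix a assume a: "a \<in> carrier A"
  have "hat B (h a) = (\<lambda>Q\<in>primes B. hat B (h a) Q)" by (simp add: hat_def fun_eq_iff)
  also have "\<dots> = (\<lambda>Q\<in>primes B. snd (Spec_map A B h) Q (hat A a (fst (Spec_map A B h) Q)))"
    using Spec_map_hat[OF A B h _ a] by (intro restrict_ext) simp
  finally show "mv_comp A (unit_mv B) h a =
      mv_comp A (Gam_map (Spec B) (Spec A) (Spec_map A B h)) (unit_mv A) a"
    using a A.hat_section[OF a] mv_homD(2)[OF h a]
    by (simp add: mv_comp_def compose_def unit_mv_def Gam_map_def split_beta Gam_simps A.pts_Spec B.pts_Spec)
qed (simp_all add: mv_comp_def compose_def)

section \<open>Sheaves of simple algebras over Stone spaces\<close>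

lemma stone_simpleD:
  assumes "stone_simple_space X"
  shows "mv_space X" "compact_space (base_space X)" "Hausdorff_space (base_space X)"
    "x \<in> pts X \<Longrightarrow> mv_simple (stalk X x)"
  using assms by (auto simp: stone_simple_space_def stone_space_def)

lemma stone_clopen_separation:
  assumes X: "stone_space X" and xy: "x \<in> topspace X" "y \<in> topspace X" "x \<noteq> y"
  obtains V where "openin X V" "closedin X V" "x \<in> V" "y \<notin> V"
proof -
  obtain U V where U: "openin X U" "x \<in> U" "y \<in> V" "disjnt U V"
    using X xy unfolding stone_space_def Hausdorff_space_def by metis
  have "openin X = arbitrary union_of (\<lambda>U. openin X U \<and> closedin X U)"
    using X by (simp add: stone_space_def)
  then obtain N where "openin X N" "closedin X N" "x \<in> N" "N \<subseteq> U"
    using U(1,2) unfolding openin_topology_base_unique by meson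
  then show ?thesis using that U(3,4) by (auto simp: disjnt_iff)
qed

lemma global_section_through:
  assumes X: "stone_simple_space X" and x: "x \<in> pts X" and e: "e \<in> carrier (stalk X x)"
  obtains s where "s \<in> carrier (Gam X)" "s x = e"
proof -
  have "e \<in> topspace (total_space X)" and ex: "proj X e = x"
    using mv_spaceD(2)[OF stone_simpleD(1)[OF X] x] e by auto
  then obtain s y where s: "s \<in> sections X (pts X)" "y \<in> pts X" "s y = e"
    using X unfolding stone_simple_space_def global_sheaf_def by meson
  then have "y = x" using sectionsD(2)[OF s(1,2)] ex by simp
  then show ?thesis using that s by (simp add: Gam_simps)
qed

lemma Gam_agree_open:
  assumes "mv_space X" "s \<in> carrier (Gam X)" "t \<in> carrier (Gam X)"
  shows "openin (base_space X) {x \<in> pts X. s x = t x}"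
  using sections_agree_open[OF mv_spaceD(1)[OF assms(1)] openin_topspace] assms(2,3)
  by (simp add: Gam_simps)

lemma Gam_eval_times:
  assumes X: "mv_space X" and s: "s \<in> carrier (Gam X)" and x: "x \<in> pts X"
  shows "mtimes (Gam X) n s x = mtimes (stalk X x) n (s x)"
  using mv_algebra.hom_times[OF Gam_algebra[OF X] Gam_eval_hom[OF X x] s, of n] s
    mv_algebra.times_closed[OF Gam_algebra[OF X] s, of n] by simp

text \<open>At each point a multiple of the section is stationary, since the value there is \<open>0\<close> or has \<open>1\<close> as a
  multiple. Stationarity of a given multiple is an open condition, so by compactness one multiple is
  stationary everywhere.\<close>

theorem Gam_hyperarchimedean:
  assumes X: "stone_simple_space X"
  shows "hyperarchimedean (Gam X)"
proof -
  note sp = stone_simpleD(1)[OF X]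
  interpret G: mv_algebra "Gam X" by (rule Gam_algebra[OF sp])
  have "\<exists>n\<ge>1. mtimes (Gam X) n s = mtimes (Gam X) (n + 1) s" if s: "s \<in> carrier (Gam X)" for s
  proof -
    note times = Gam_eval_times[OF sp s]
    define U where "U n = {x \<in> pts X. mtimes (Gam X) n s x = mtimes (Gam X) (Suc n) s x}" for n
    have "\<exists>n. x \<in> U n" if x: "x \<in> pts X" for x
    proof -
      interpret S: mv_algebra "stalk X x" by (rule mv_spaceD(4)[OF sp x])
      have sx: "s x \<in> carrier (stalk X x)" using section_value[OF sp _ x x] s by (simp add: Gam_simps)
      show ?thesis
      proof (cases "s x = mzero (stalk X x)")
        case True
        then have "x \<in> U 0" using x sx by (simp only: U_def times mem_Collect_eq) (simp add: S.plus_zero)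
        then show ?thesis ..
      next
        case False
        then obtain n where "mtimes (stalk X x) n (s x) = mone (stalk X x)"
          using simple_times_one[OF stone_simpleD(4)[OF X x] sx] by metis
        then have "x \<in> U n" using x sx by (simp only: U_def times mem_Collect_eq) (simp add: S.plus_one)
        then show ?thesis ..
      qed
    qed
    then have "pts X \<subseteq> \<Union>(range U)" by blast
    moreover have "\<forall>V\<in>range U. openin (base_space X) V"
      using Gam_agree_open[OF sp] G.times_closed[OF s] unfolding U_def by blast
    ultimately obtain \<V> where V: "finite \<V>" "\<V> \<subseteq> range U" "pts X \<subseteq> \<Union>\<V>"
      using stone_simpleD(2)[OF X] unfolding compact_space_alt by metis
    obtain C where C: "finite C" "\<V> = U ` C" using finite_subset_image[OF V(1,2)] by auto
    obtain k where k: "\<forall>n\<in>C. n \<le> k" using C(1) finite_nat_set_iff_bounded_le by blast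
    have stable: "mtimes (Gam X) m s x = mtimes (Gam X) k s x" if x: "x \<in> pts X" and m: "k \<le> m" for x m
    proof -
      interpret S: mv_algebra "stalk X x" by (rule mv_spaceD(4)[OF sp x])
      have sx: "s x \<in> carrier (stalk X x)" using section_value[OF sp _ x x] s by (simp add: Gam_simps)
      obtain n where n: "n \<in> C" "x \<in> U n" using V(3) C(2) x by blast
      then have "mtimes (stalk X x) n (s x) = mtimes (stalk X x) (Suc n) (s x)"
        using x unfolding U_def mem_Collect_eq times[OF x] by blast
      then have st: "mtimes (stalk X x) j (s x) = mtimes (stalk X x) n (s x)" if "n \<le> j" for j
        using S.times_stable[OF sx _ that] by blast
      have "n \<le> k" using k n(1) by blast
      then show ?thesis using st[of m] st[of k] m unfolding times[OF x] by simp
    qed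
    have ext: "mtimes (Gam X) n s \<in> extensional (pts X)" for n
      using sectionsD(1) G.times_closed[OF s, of n] by (simp add: Gam_simps(1))
    \<comment> \<open>The bound \<open>k\<close> may be \<open>0\<close>, whereas the multiple is required to be at least \<open>1\<close>.\<close>
    have "mtimes (Gam X) (Suc k) s = mtimes (Gam X) (Suc k + 1) s"
    proof (rule extensionalityI[OF ext ext])
      show "mtimes (Gam X) (Suc k) s x = mtimes (Gam X) (Suc k + 1) s x" if "x \<in> pts X" for x
        using stable[OF that, of "Suc k"] stable[OF that, of "Suc k + 1"] by (simp only: le_add1 le_SucI le_refl Suc_eq_plus1 add.assoc)
    qed
    then show ?thesis by (intro exI[of _ "Suc k"]) (simp only: le_add2 Suc_eq_plus1 simp_thms)
  qed
  then show ?thesis using Gam_algebra[OF sp] unfolding hyperarchimedean_def by blast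
qed

lemma Gam_glue:
  assumes V: "openin (base_space X) V" "closedin (base_space X) V"
    and s: "s \<in> carrier (Gam X)" and t: "t \<in> carrier (Gam X)"
  shows "(\<lambda>x\<in>pts X. if x \<in> V then s x else t x) \<in> carrier (Gam X)"
  unfolding Gam_simps
proof (rule sections_local)
  have C: "openin (base_space X) (pts X - V)" using V(2) by blast
  fix x assume x: "x \<in> pts X"
  show "\<exists>W r. openin (base_space X) W \<and> x \<in> W \<and> r \<in> sections X W \<and>
      (\<forall>y\<in>W \<inter> pts X. (\<lambda>x\<in>pts X. if x \<in> V then s x else t x) y = r y)"
  proof (cases "x \<in> V")
    case True
    then show ?thesis
      using V(1) sections_restrict[OF _ openin_topspace V(1) openin_subset[OF V(1)]] s
      by (intro exI[of _ V] exI[of _ "restrict s V"]) (auto simp: Gam_simps)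
  next
    case False
    then show ?thesis
      using x C sections_restrict[OF _ openin_topspace C] t
      by (intro exI[of _ "pts X - V"] exI[of _ "restrict t (pts X - V)"]) (auto simp: Gam_simps)
  qed
qed simp_all

section \<open>The unit of an MV-space\<close>

lemma vanishing_prime:
  assumes X: "mv_space X" and x: "x \<in> pts X"
  shows "vanishing X x \<in> primes (Gam X)"
proof -
  have "mv_prime (Gam X) {s \<in> carrier (Gam X). (\<lambda>s\<in>carrier (Gam X). s x) s \<in> {mzero (stalk X x)}}"
    by (rule mv_algebra.prime_preimage[OF Gam_algebra[OF X] Gam_eval_hom[OF X x] mv_spaceD(4)[OF X x]
      chain_zero_prime[OF mv_spaceD(3)[OF X x]]])
  also have "{s \<in> carrier (Gam X). (\<lambda>s\<in>carrier (Gam X). s x) s \<in> {mzero (stalk X x)}} = vanishing X x"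
    by (auto simp: vanishing_def)
  finally show ?thesis by (simp add: primes_def)
qed

lemma dist_vanishing_iff:
  assumes X: "mv_space X" and x: "x \<in> pts X" and s: "s \<in> carrier (Gam X)" and t: "t \<in> carrier (Gam X)"
  shows "mdist (Gam X) s t \<in> vanishing X x \<longleftrightarrow> s x = t x"
proof -
  interpret G: mv_algebra "Gam X" by (rule Gam_algebra[OF X])
  interpret S: mv_algebra "stalk X x" by (rule mv_spaceD(4)[OF X x])
  have val: "s x \<in> carrier (stalk X x)" "t x \<in> carrier (stalk X x)"
    using section_value[OF X _ x x] s t by (simp_all add: Gam_simps)
  have "mdist (Gam X) s t x = mdist (stalk X x) (s x) (t x)"
    using G.hom_dist[OF Gam_eval_hom[OF X x] s t] s t by (simp add: G.closed)
  then show ?thesis using S.dist_zero_iff[OF val] s t by (simp add: vanishing_def G.closed)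
qed

lemma fst_unit_mvs: "x \<in> pts X \<Longrightarrow> fst (unit_mvs X) x = vanishing X x"
  by (simp add: unit_mvs_def)

text \<open>All sections in one class modulo the sections vanishing at \<open>x\<close> have the same value at \<open>x\<close>, so the
  stalk map is evaluation.\<close>

lemma unit_mvs_hat:
  assumes X: "mv_space X" and x: "x \<in> pts X" and s: "s \<in> carrier (Gam X)"
  shows "snd (unit_mvs X) x (hat (Gam X) s (vanishing X x)) = s x"
proof -
  interpret G: mv_algebra "Gam X" by (rule Gam_algebra[OF X])
  note P = vanishing_prime[OF X x]
  define C where "C = mv_cong (Gam X) (vanishing X x) `` {s}"
  have sC: "s \<in> C" unfolding C_def by (rule equiv_class_self[OF G.equiv_cong[OF G.primes_ideal[OF P]] s])
  have const: "t x = s x" if "t \<in> C" for t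
    using that dist_vanishing_iff[OF X x s] by (auto simp: C_def mv_cong_def)
  have "(\<lambda>s. s x) ` C = {s x}"
  proof
    show "(\<lambda>s. s x) ` C \<subseteq> {s x}" using const by blast
    show "{s x} \<subseteq> (\<lambda>s. s x) ` C" using sC by blast
  qed
  moreover have "hat (Gam X) s (vanishing X x) \<in> carrier (tagged_quot (Gam X) (vanishing X x))"
    using G.carrier_tagged_quot[OF P] s by blast
  moreover have "snd (hat (Gam X) s (vanishing X x)) = C"
    using P by (simp add: hat_def C_def)
  ultimately show ?thesis using x by (simp add: unit_mvs_def)
qed

theorem unit_mvs_hom:
  assumes X: "mv_space X"
  shows "unit_mvs X \<in> mvs_hom X (Spec (Gam X))"
proof -
  interpret G: mv_algebra "Gam X" by (rule Gam_algebra[OF X])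
  let ?u = "unit_mvs X"
  note pt = fst_unit_mvs
  note prime = vanishing_prime[OF X]
  note val = unit_mvs_hat[OF X]
  have pre_W: "openin (base_space X) {x \<in> pts X. vanishing X x \<in> W (Gam X) s}" if s: "s \<in> carrier (Gam X)" for s
  proof -
    have "{x \<in> pts X. vanishing X x \<in> W (Gam X) s} = {x \<in> pts X. s x = mzero (Gam X) x}"
      using prime s by (auto simp: W_def vanishing_def Gam_simps)
    then show ?thesis using Gam_agree_open[OF X s G.zero_closed] by simp
  qed
  have pre: "openin (base_space X) {x \<in> pts X. fst ?u x \<in> V}" if V: "openin (base_space (Spec (Gam X))) V" for V
  proof (subst openin_subopen, intro ballI)
    fix x assume x: "x \<in> {x \<in> pts X. fst ?u x \<in> V}"
    then have "vanishing X x \<in> V" using pt[of x X] by simp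
    then obtain s where s: "s \<in> carrier (Gam X)" "vanishing X x \<in> W (Gam X) s" "W (Gam X) s \<subseteq> V"
      using V unfolding G.openin_Spec by meson
    have "{x \<in> pts X. vanishing X x \<in> W (Gam X) s} \<subseteq> {x \<in> pts X. fst ?u x \<in> V}"
      using s(3) by (auto simp: pt)
    then show "\<exists>T. openin (base_space X) T \<and> x \<in> T \<and> T \<subseteq> {x \<in> pts X. fst ?u x \<in> V}"
      using pre_W[OF s(1)] s(2) x by (intro exI[of _ "{x \<in> pts X. vanishing X x \<in> W (Gam X) s}"]) auto
  qed
  have cont: "continuous_map (base_space X) (base_space (Spec (Gam X))) (fst ?u)"
    using pre prime by (auto simp: continuous_map_def G.pts_Spec pt)
  have hom: "snd ?u x \<in> mv_hom (tagged_quot (Gam X) (fst ?u x)) (stalk X x)" if x: "x \<in> pts X" for x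
    unfolding pt[OF x]
  proof (rule mv_homI)
    note P = prime[OF x]
    note cQ = G.carrier_tagged_quot[OF P]
    note simps = G.hat_simps[OF P] val[OF x] G.closed
    show "snd ?u x \<in> extensional (carrier (tagged_quot (Gam X) (vanishing X x)))"
      using x by (simp add: unit_mvs_def)
    fix c assume "c \<in> carrier (tagged_quot (Gam X) (vanishing X x))"
    then obtain s where s: "s \<in> carrier (Gam X)" "c = hat (Gam X) s (vanishing X x)" unfolding cQ by blast
    then show "snd ?u x c \<in> carrier (stalk X x)"
      using section_value[OF X _ x x] by (simp add: simps) (simp add: Gam_simps)
    show "snd ?u x (mneg (tagged_quot (Gam X) (vanishing X x)) c) = mneg (stalk X x) (snd ?u x c)"
      using s x by (simp add: simps) (simp add: Gam_simps)
    fix d assume "d \<in> carrier (tagged_quot (Gam X) (vanishing X x))"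
    then obtain t where "t \<in> carrier (Gam X)" "d = hat (Gam X) t (vanishing X x)" unfolding cQ by blast
    then show "snd ?u x (mplus (tagged_quot (Gam X) (vanishing X x)) c d) =
        mplus (stalk X x) (snd ?u x c) (snd ?u x d)"
      using s x by (simp add: simps) (simp add: Gam_simps)
  next
    show "snd ?u x (mzero (tagged_quot (Gam X) (vanishing X x))) = mzero (stalk X x)"
      using G.hat_simps(3)[OF prime[OF x]] val[OF x G.zero_closed] x by (simp add: Gam_simps)
  qed
  have sec: "(\<lambda>x\<in>{x \<in> pts X. fst ?u x \<in> V}. snd ?u x (t (fst ?u x))) \<in> sections X {x \<in> pts X. fst ?u x \<in> V}"
    if V: "openin (base_space (Spec (Gam X))) V" and t: "t \<in> sections (Spec (Gam X)) V" for V t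
  proof (rule sections_local[OF pre[OF V]])
    fix x assume x: "x \<in> {x \<in> pts X. fst ?u x \<in> V}"
    then have "fst ?u x \<in> V" by simp
    then obtain s N where N: "s \<in> carrier (Gam X)" "openin (base_space (Spec (Gam X))) N" "fst ?u x \<in> N"
      "N \<subseteq> V" "\<forall>Q\<in>N. t Q = hat (Gam X) s Q"
      using t unfolding G.sections_Spec[OF V] by blast
    let ?M = "{x \<in> pts X. fst ?u x \<in> N}"
    have "restrict s ?M \<in> sections X ?M"
      using sections_restrict[OF _ openin_topspace pre[OF N(2)]] N(1) by (simp add: Gam_simps)
    moreover have "snd ?u y (t (fst ?u y)) = s y" if "y \<in> ?M" for y
      using that N(5) val[OF _ N(1), of y] pt[of y X] by simp
    ultimately show "\<exists>M r. openin (base_space X) M \<and> x \<in> M \<and> r \<in> sections X M \<and>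
        (\<forall>y\<in>M \<inter> {x \<in> pts X. fst ?u x \<in> V}.
          (\<lambda>x\<in>{x \<in> pts X. fst ?u x \<in> V}. snd ?u x (t (fst ?u x))) y = r y)"
      using pre[OF N(2)] N(3) x by (intro exI[of _ ?M] exI[of _ "restrict s ?M"]) auto
  qed simp
  have ext: "fst ?u \<in> extensional (pts X)" "snd ?u \<in> extensional (pts X)" by (simp_all add: unit_mvs_def)
  show ?thesis
    unfolding mvs_hom_iff using ext cont hom sec by (simp add: Spec_simps)
qed

text \<open>Distinct points are separated by a clopen set; the section that is \<open>0\<close> on it and \<open>1\<close> off it vanishes
  at only one of them.\<close>

lemma vanishing_inj:
  assumes X: "stone_simple_space X"
  shows "inj_on (vanishing X) (pts X)"
proof (rule inj_onI, rule ccontr)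
  note sp = stone_simpleD(1)[OF X]
  interpret G: mv_algebra "Gam X" by (rule Gam_algebra[OF sp])
  fix x y assume xy: "x \<in> pts X" "y \<in> pts X" "vanishing X x = vanishing X y" "x \<noteq> y"
  obtain V where V: "openin (base_space X) V" "closedin (base_space X) V" "x \<in> V" "y \<notin> V"
    using stone_clopen_separation[OF _ xy(1,2,4)] X unfolding stone_simple_space_def by metis
  define s where "s = (\<lambda>z\<in>pts X. if z \<in> V then mzero (Gam X) z else mone (Gam X) z)"
  have "s \<in> carrier (Gam X)"
    unfolding s_def by (rule Gam_glue[OF V(1,2) G.zero_closed G.one_closed])
  moreover have "s x = mzero (stalk X x)" "s y = mone (stalk X y)"
    using V(3,4) xy(1,2) by (simp_all add: s_def mone_def Gam_simps)
  moreover have "mone (stalk X y) \<noteq> mzero (stalk X y)"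
    using mv_spaceD(3)[OF sp xy(2)] by (simp add: mv_chain_def mv_nontrivial_def)
  ultimately have "s \<in> vanishing X x" "s \<notin> vanishing X y" by (simp_all add: vanishing_def)
  then show False using xy(3) by simp
qed

text \<open>If a prime \<open>P\<close> of global sections had no common zero, then around each point some member of \<open>P\<close>,
  suitably multiplied, would be constantly \<open>1\<close>; by compactness a finite sum of such members is \<open>1\<close>
  everywhere, contrary to \<open>1 \<notin> P\<close>. So \<open>P\<close> is contained in the prime of a point, and in a
  hyperarchimedean algebra there are no proper inclusions between primes.\<close>

lemma vanishing_surj:
  assumes X: "stone_simple_space X" and P: "P \<in> primes (Gam X)"
  obtains x where "x \<in> pts X" "P = vanishing X x"
proof -
  note sp = stone_simpleD(1)[OF X]
  interpret G: mv_algebra "Gam X" by (rule Gam_algebra[OF sp])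
  have prime: "mv_prime (Gam X) P" using P by (simp add: primes_def)
  note D = G.idealD[OF G.primes_ideal[OF P]]
  have "\<exists>x\<in>pts X. P \<subseteq> vanishing X x"
  proof (rule ccontr)
    assume no: "\<not> ?thesis"
    define U where "U s = {x \<in> pts X. s x = mone (Gam X) x}" for s
    have "\<exists>s\<in>P. x \<in> U s" if x: "x \<in> pts X" for x
    proof -
      obtain s where s: "s \<in> P" "s \<notin> vanishing X x" using no x by blast
      then have sG: "s \<in> carrier (Gam X)" and "s x \<noteq> mzero (stalk X x)" using D(1) by (auto simp: vanishing_def)
      moreover have "s x \<in> carrier (stalk X x)" using section_value[OF sp _ x x] sG by (simp add: Gam_simps)
      ultimately obtain n where "mtimes (stalk X x) n (s x) = mone (stalk X x)"
        using simple_times_one[OF stone_simpleD(4)[OF X x]] by metis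
      then have "mtimes (Gam X) n s x = mone (Gam X) x"
        using Gam_eval_times[OF sp sG x] x by (simp add: mone_def Gam_simps)
      then have "x \<in> U (mtimes (Gam X) n s)" using x by (simp add: U_def)
      then show ?thesis using G.ideal_times[OF G.primes_ideal[OF P] s(1)] by blast
    qed
    then have "pts X \<subseteq> \<Union>(U ` P)" by blast
    moreover have "\<forall>V\<in>U ` P. openin (base_space X) V"
      using Gam_agree_open[OF sp _ G.one_closed] D(1) unfolding U_def by blast
    ultimately obtain \<V> where V: "finite \<V>" "\<V> \<subseteq> U ` P" "pts X \<subseteq> \<Union>\<V>"
      using stone_simpleD(2)[OF X] unfolding compact_space_alt by metis
    have "\<exists>r\<in>P. \<Union>\<V> \<subseteq> U r"
      using V(1,2)
    proof (induction \<V> rule: finite_induct)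
      case empty
      then show ?case using D(2) by auto
    next
      case (insert N \<V>)
      have "\<V> \<subseteq> U ` P" "N \<in> U ` P" using insert.prems by simp_all
      obtain r where r: "r \<in> P" "\<Union>\<V> \<subseteq> U r" using insert.IH[OF \<open>\<V> \<subseteq> U ` P\<close>] by meson
      obtain s where s: "s \<in> P" "N = U s" using \<open>N \<in> U ` P\<close> by (rule imageE)
      have rs: "r \<in> carrier (Gam X)" "s \<in> carrier (Gam X)" using D(1)[OF r(1)] D(1)[OF s(1)] .
      have "x \<in> U (s \<oplus>\<^bsub>Gam X\<^esub> r)" if "x \<in> U s \<or> x \<in> U r" for x
      proof -
        have x: "x \<in> pts X" using that by (auto simp: U_def)
        interpret S: mv_algebra "stalk X x" by (rule mv_spaceD(4)[OF sp x])
        have "s x \<in> carrier (stalk X x)" "r x \<in> carrier (stalk X x)"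
          using section_value[OF sp _ x x] rs by (simp_all add: Gam_simps)
        moreover have "mone (Gam X) x = mone (stalk X x)" using x by (simp add: mone_def Gam_simps)
        ultimately show ?thesis
          using that x S.plus_one S.plus_comm[of "s x" "r x"] by (auto simp: U_def Gam_simps)
      qed
      then have "U s \<union> U r \<subseteq> U (s \<oplus>\<^bsub>Gam X\<^esub> r)" by blast
      then have "\<Union>(insert N \<V>) \<subseteq> U (s \<oplus>\<^bsub>Gam X\<^esub> r)" using r(2) s(2) by auto
      then show ?case using D(4)[OF s(1) r(1)] by blast
    qed
    then obtain r where rV: "r \<in> P" "\<Union>\<V> \<subseteq> U r" by (rule bexE)
    then have r: "r \<in> P" "pts X \<subseteq> U r" using subset_trans[OF V(3)] by simp_all
    have "r = mone (Gam X)"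
    proof (rule extensionalityI)
      show "r \<in> extensional (pts X)" "mone (Gam X) \<in> extensional (pts X)"
        using D(1)[OF r(1)] G.one_closed by (auto simp: Gam_simps(1) intro: sectionsD(1))
      show "r x = mone (Gam X) x" if "x \<in> pts X" for x using r(2) that by (auto simp: U_def)
    qed
    then show False using r(1) G.primeD(2)[OF prime] by simp
  qed
  then obtain x where x: "x \<in> pts X" "P \<subseteq> vanishing X x" by blast
  have Q: "mv_prime (Gam X) (vanishing X x)" using vanishing_prime[OF sp x(1)] by (simp add: primes_def)
  have "s \<in> P" if s: "s \<in> vanishing X x" for s
  proof -
    have "s \<in> carrier (Gam X)" using s by (simp add: vanishing_def)
    then obtain e where "\<And>P. mv_prime (Gam X) P \<Longrightarrow> mneg (Gam X) e \<in> P \<longleftrightarrow> s \<notin> P"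
      using hyperarchimedean_boolean[OF Gam_hyperarchimedean[OF X]] by metis
    then show ?thesis using prime Q s x(2) by blast
  qed
  then show ?thesis using that x by blast
qed

text \<open>The map on points is a continuous bijection from a compact space to a Hausdorff space, hence a
  homeomorphism. On stalks, evaluation is injective by the choice of the prime and surjective because
  the sheaf is global. The inverse is again a morphism because a section through the value of a global
  section agrees with that global section on a neighbourhood.\<close>

theorem unit_mvs_iso:
  assumes X: "stone_simple_space X"
  shows "mvs_iso X (Spec (Gam X)) (unit_mvs X)"
proof -
  note sp = stone_simpleD(1)[OF X]
  interpret G: mv_algebra "Gam X" by (rule Gam_algebra[OF sp])
  let ?Y = "Spec (Gam X)" and ?u = "unit_mvs X"
  note u = unit_mvs_hom[OF sp]
  have "homeomorphic_map (base_space X) (base_space ?Y) (fst ?u)"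
  proof (rule continuous_imp_homeomorphic_map)
    show "continuous_map (base_space X) (base_space ?Y) (fst ?u)" using u by (simp add: mvs_hom_iff)
    show "compact_space (base_space X)" by (rule stone_simpleD(2)[OF X])
    show "Hausdorff_space (base_space ?Y)" by (rule Spec_Hausdorff[OF Gam_hyperarchimedean[OF X]])
    show "fst ?u ` pts X = pts ?Y"
      using vanishing_prime[OF sp] vanishing_surj[OF X]
      by (auto simp: G.pts_Spec fst_unit_mvs image_iff) metis
    show "inj_on (fst ?u) (pts X)" using vanishing_inj[OF X] by (simp add: inj_on_def fst_unit_mvs)
  qed
  then obtain g where g: "homeomorphic_maps (base_space X) (base_space ?Y) (fst ?u) g"
    unfolding homeomorphic_map_maps by blast
  have g_pts: "g P \<in> pts X" "vanishing X (g P) = P" if "P \<in> primes (Gam X)" for P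
  proof -
    show gP: "g P \<in> pts X" using g that by (auto simp: homeomorphic_maps_def continuous_map_def G.pts_Spec)
    have "fst ?u (g P) = P" using g that by (simp add: homeomorphic_maps_def G.pts_Spec)
    then show "vanishing X (g P) = P" using fst_unit_mvs[OF gP] by simp
  qed
  have g_van: "g (vanishing X x) = x" if "x \<in> pts X" for x
    using g that by (auto simp: homeomorphic_maps_def fst_unit_mvs)
  \<comment> \<open>On stalks the inverse sends a germ to the class of a global section through it; the choice does not
      matter, because sections that agree at \<open>g P\<close> are congruent modulo \<open>P\<close>.\<close>
  define \<gamma> where "\<gamma> P e = hat (Gam X) (SOME s. s \<in> carrier (Gam X) \<and> s (g P) = e) P" for P e
  have \<gamma>: "\<gamma> P (s (g P)) = hat (Gam X) s P" if P: "P \<in> primes (Gam X)" and s: "s \<in> carrier (Gam X)" for P s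
  proof -
    define t where "t = (SOME t. t \<in> carrier (Gam X) \<and> t (g P) = s (g P))"
    have "t \<in> carrier (Gam X) \<and> t (g P) = s (g P)"
      unfolding t_def by (rule someI[of _ s]) (use s in simp)
    moreover from this have "mdist (Gam X) t s \<in> P"
      using dist_vanishing_iff[OF sp g_pts(1)[OF P]] s g_pts(2)[OF P] by simp
    ultimately show ?thesis using G.hat_eq_iff[OF P] s unfolding \<gamma>_def t_def[symmetric] by blast
  qed
  define n where "n = ((\<lambda>P\<in>primes (Gam X). g P), \<lambda>P\<in>primes (Gam X). \<lambda>e\<in>carrier (stalk X (g P)). \<gamma> P e)"
  have n_fst: "fst n P = g P" if "P \<in> primes (Gam X)" for P using that by (simp add: n_def)
  have n_snd: "snd n P (s (g P)) = hat (Gam X) s P" if P: "P \<in> primes (Gam X)" and s: "s \<in> carrier (Gam X)" for P s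
    using section_value[OF sp _ g_pts(1)[OF P] g_pts(1)[OF P]] s P \<gamma>[OF P s] by (simp add: n_def Gam_simps)
  have germ: "\<exists>s\<in>carrier (Gam X). e = s x" if "x \<in> pts X" "e \<in> carrier (stalk X x)" for x e
    using global_section_through[OF X that] by metis
  have pre: "openin (base_space ?Y) {P \<in> pts ?Y. fst n P \<in> V}" if V: "openin (base_space X) V" for V
  proof -
    have "openin (base_space ?Y) {P \<in> pts ?Y. g P \<in> V}"
      using g V by (simp add: homeomorphic_maps_def continuous_map_def)
    also have "{P \<in> pts ?Y. g P \<in> V} = {P \<in> pts ?Y. fst n P \<in> V}" by (auto simp: G.pts_Spec n_fst)
    finally show ?thesis .
  qed
  have "n \<in> mvs_hom ?Y X"
    unfolding mvs_hom_iff
  proof (intro conjI ballI allI impI)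
    show "fst n \<in> extensional (pts ?Y)" "snd n \<in> extensional (pts ?Y)" by (simp_all add: n_def G.pts_Spec)
    show "continuous_map (base_space ?Y) (base_space X) (fst n)"
      using pre g_pts by (auto simp: continuous_map_def G.pts_Spec n_fst)
  next
    fix P assume "P \<in> pts ?Y"
    then have P: "P \<in> primes (Gam X)" by (simp add: G.pts_Spec)
    note x = g_pts(1)[OF P]
    note simps = n_snd[OF P, symmetric] G.hat_simps[OF P] G.closed
    show "snd n P \<in> mv_hom (stalk X (fst n P)) (stalk ?Y P)"
      unfolding n_fst[OF P] Spec_simps
    proof (rule mv_homI)
      show "snd n P \<in> extensional (carrier (stalk X (g P)))" using P by (simp add: n_def)
      fix e assume "e \<in> carrier (stalk X (g P))"
      then obtain s where s: "s \<in> carrier (Gam X)" "e = s (g P)" using germ[OF x] by blast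
      then show "snd n P e \<in> carrier (tagged_quot (Gam X) P)"
        using n_snd[OF P s(1)] G.carrier_tagged_quot[OF P] by simp
      have "mneg (stalk X (g P)) e = mneg (Gam X) s (g P)" using x s(2) by (simp add: Gam_simps)
      then show "snd n P (mneg (stalk X (g P)) e) = mneg (tagged_quot (Gam X) P) (snd n P e)"
        using n_snd[OF P] s G.hat_simps(2)[OF P] by (simp add: G.closed)
      fix d assume "d \<in> carrier (stalk X (g P))"
      then obtain t where t: "t \<in> carrier (Gam X)" "d = t (g P)" using germ[OF x] by blast
      have "mplus (stalk X (g P)) e d = (s \<oplus>\<^bsub>Gam X\<^esub> t) (g P)" using x s(2) t(2) by (simp add: Gam_simps)
      then show "snd n P (mplus (stalk X (g P)) e d) = mplus (tagged_quot (Gam X) P) (snd n P e) (snd n P d)"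
        using n_snd[OF P] s t G.hat_simps(1)[OF P] by (simp add: G.closed)
    next
      have "mzero (stalk X (g P)) = mzero (Gam X) (g P)" using x by (simp add: Gam_simps)
      then show "snd n P (mzero (stalk X (g P))) = mzero (tagged_quot (Gam X) P)"
        using n_snd[OF P G.zero_closed] G.hat_simps(3)[OF P] by simp
    qed
  next
    fix V t assume V: "openin (base_space X) V" and t: "t \<in> sections X V"
    let ?M = "{P \<in> pts ?Y. fst n P \<in> V}"
    show "(\<lambda>P\<in>?M. snd n P (t (fst n P))) \<in> sections ?Y ?M"
      unfolding G.sections_Spec[OF pre[OF V]]
    proof (intro conjI ballI)
      fix P assume "P \<in> ?M"
      then have P: "P \<in> primes (Gam X)" and gV: "g P \<in> V" by (auto simp: G.pts_Spec n_fst)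
      obtain s where s: "s \<in> carrier (Gam X)" "t (g P) = s (g P)"
        using germ[OF g_pts(1)[OF P]] section_value[OF sp t gV g_pts(1)[OF P]] by blast
      let ?N = "{x \<in> V. t x = restrict s V x}"
      have "restrict s V \<in> sections X V"
        using sections_restrict[OF _ openin_topspace V openin_subset[OF V]] s(1) by (simp add: Gam_simps)
      then have N: "openin (base_space X) ?N" by (rule sections_agree_open[OF mv_spaceD(1)[OF sp] V t])
      have "snd n Q (t (fst n Q)) = hat (Gam X) s Q" if "Q \<in> pts ?Y" "fst n Q \<in> ?N" for Q
        using that n_snd[OF _ s(1)] by (auto simp: G.pts_Spec n_fst)
      then show "\<exists>a\<in>carrier (Gam X). \<exists>N. openin (base_space ?Y) N \<and> P \<in> N \<and> N \<subseteq> ?M \<and>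
          (\<forall>Q\<in>N. (\<lambda>P\<in>?M. snd n P (t (fst n P))) Q = hat (Gam X) a Q)"
        using s P gV pre[OF N]
        by (intro bexI[of _ s] exI[of _ "{Q \<in> pts ?Y. fst n Q \<in> ?N}"]) (auto simp: G.pts_Spec n_fst)
    qed simp
  qed
  moreover have "mvs_comp X X n ?u = mvs_id X"
  proof (rule prod_eqI)
    show "fst (mvs_comp X X n ?u) = fst (mvs_id X)"
      using vanishing_prime[OF sp] g_van
      by (auto simp: mvs_comp_simps mvs_id_def compose_def fst_unit_mvs n_fst intro!: restrict_ext)
    have "mv_comp (stalk X (fst n (fst ?u x))) (snd ?u x) (snd n (fst ?u x)) = mv_id (stalk X x)"
      if x: "x \<in> pts X" for x
    proof -
      note P = vanishing_prime[OF sp x]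
      have "snd ?u x (snd n (vanishing X x) e) = e" if e: "e \<in> carrier (stalk X x)" for e
      proof -
        obtain s where s: "s \<in> carrier (Gam X)" "e = s x" using germ[OF x e] by blast
        then show ?thesis using n_snd[OF P s(1)] unit_mvs_hat[OF sp x s(1)] g_van[OF x] by simp
      qed
      then show ?thesis
        using x P g_van by (auto simp: mv_comp_def mv_id_def compose_def fst_unit_mvs n_fst intro!: restrict_ext)
    qed
    then show "snd (mvs_comp X X n ?u) = snd (mvs_id X)"
      by (auto simp: mvs_comp_simps mvs_id_def intro!: restrict_ext)
  qed
  moreover have "mvs_comp ?Y ?Y ?u n = mvs_id ?Y"
  proof (rule prod_eqI)
    show "fst (mvs_comp ?Y ?Y ?u n) = fst (mvs_id ?Y)"
      using g_pts by (auto simp: mvs_comp_simps mvs_id_def compose_def fst_unit_mvs n_fst G.pts_Spec intro!: restrict_ext)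
    have "mv_comp (stalk ?Y (fst ?u (fst n P))) (snd n P) (snd ?u (fst n P)) = mv_id (stalk ?Y P)"
      if P: "P \<in> primes (Gam X)" for P
    proof -
      have "snd n P (snd ?u (g P) c) = c" if c: "c \<in> carrier (tagged_quot (Gam X) P)" for c
      proof -
        obtain s where s: "s \<in> carrier (Gam X)" "c = hat (Gam X) s P"
          using c unfolding G.carrier_tagged_quot[OF P] by blast
        then show ?thesis
          using n_snd[OF P s(1)] unit_mvs_hat[OF sp g_pts(1)[OF P] s(1)] g_pts(2)[OF P] by simp
      qed
      then show ?thesis
        using P g_pts by (auto simp: mv_comp_def mv_id_def compose_def fst_unit_mvs n_fst Spec_simps intro!: restrict_ext)
    qed
    then show "snd (mvs_comp ?Y ?Y ?u n) = snd (mvs_id ?Y)"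
      by (auto simp: mvs_comp_simps mvs_id_def G.pts_Spec intro!: restrict_ext)
  qed
  ultimately show ?thesis using u unfolding mvs_iso_def by blast
qed

text \<open>Both composites send \<open>x\<close> to the sections vanishing at \<open>f x\<close>: the right-hand side gives the sections
  \<open>s\<close> with \<open>\<phi> x (s (f x)) = 0\<close>, and \<open>\<phi> x\<close> is injective because its source is simple.\<close>

theorem unit_mvs_natural:
  assumes X: "mv_space X" and Y: "mv_space Y" and simple: "\<And>y. y \<in> pts Y \<Longrightarrow> mv_simple (stalk Y y)"
    and m: "m \<in> mvs_hom X Y"
  shows "mvs_comp X (Spec (Gam Y)) (unit_mvs Y) m =
    mvs_comp X (Spec (Gam Y)) (Spec_map (Gam Y) (Gam X) (Gam_map X Y m)) (unit_mvs X)"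
proof -
  interpret GX: mv_algebra "Gam X" by (rule Gam_algebra[OF X])
  interpret GY: mv_algebra "Gam Y" by (rule Gam_algebra[OF Y])
  let ?h = "Gam_map X Y m" and ?uX = "unit_mvs X" and ?uY = "unit_mvs Y"
  let ?S = "Spec_map (Gam Y) (Gam X) ?h"
  note h = Gam_map_hom[OF X Y m]
  have f: "fst m x \<in> pts Y" if "x \<in> pts X" for x
    using m that by (auto simp: mvs_hom_iff continuous_map_def)
  have \<phi>: "snd m x \<in> mv_hom (stalk Y (fst m x)) (stalk X x)" if "x \<in> pts X" for x
    using m that by (simp add: mvs_hom_iff)
  have hx: "?h s x = snd m x (s (fst m x))" if "x \<in> pts X" "s \<in> carrier (Gam Y)" for x s
    using that by (simp add: Gam_map_def split_beta)
  have pt: "fst ?S (vanishing X x) = vanishing Y (fst m x)" if x: "x \<in> pts X" for x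
  proof -
    note inj = simple_hom_inj[OF simple[OF f[OF x]] mv_spaceD(3)[OF X x] \<phi>[OF x]]
    have zero: "mzero (stalk Y (fst m x)) \<in> carrier (stalk Y (fst m x))"
      using mv_algebra.zero_closed[OF mv_spaceD(4)[OF Y f[OF x]]] .
    have "?h s \<in> vanishing X x \<longleftrightarrow> s (fst m x) = mzero (stalk Y (fst m x))" if s: "s \<in> carrier (Gam Y)" for s
    proof -
      have "s (fst m x) \<in> carrier (stalk Y (fst m x))"
        using section_value[OF Y _ f[OF x] f[OF x]] s by (simp add: Gam_simps)
      then have "snd m x (s (fst m x)) = mzero (stalk X x) \<longleftrightarrow> s (fst m x) = mzero (stalk Y (fst m x))"
        using inj_on_eq_iff[OF inj _ zero] mv_homD(5)[OF \<phi>[OF x]] by simp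
      then show ?thesis using hx[OF x s] mv_homD(2)[OF h s] by (simp add: vanishing_def)
    qed
    then show ?thesis
      using Spec_map_prime(2)[OF GY.mv_algebra_axioms GX.mv_algebra_axioms h vanishing_prime[OF X x]]
      by (auto simp: vanishing_def[of Y])
  qed
  show ?thesis
  proof (rule prod_eqI)
    show "fst (mvs_comp X (Spec (Gam Y)) ?uY m) = fst (mvs_comp X (Spec (Gam Y)) ?S ?uX)"
      using pt f by (auto simp: mvs_comp_simps compose_def fst_unit_mvs intro!: restrict_ext)
    have "mv_comp (stalk (Spec (Gam Y)) (fst ?uY (fst m x))) (snd m x) (snd ?uY (fst m x)) =
        mv_comp (stalk (Spec (Gam Y)) (fst ?S (fst ?uX x))) (snd ?uX x) (snd ?S (fst ?uX x))"
      if x: "x \<in> pts X" for x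
    proof -
      note P = vanishing_prime[OF Y f[OF x]]
      have "snd m x (snd ?uY (fst m x) c) = snd ?uX x (snd ?S (vanishing X x) c)"
        if c: "c \<in> carrier (tagged_quot (Gam Y) (vanishing Y (fst m x)))" for c
      proof -
        obtain s where s: "s \<in> carrier (Gam Y)" "c = hat (Gam Y) s (vanishing Y (fst m x))"
          using c unfolding GY.carrier_tagged_quot[OF P] by blast
        have "snd ?S (vanishing X x) c = hat (Gam X) (?h s) (vanishing X x)"
          using Spec_map_hat[OF GY.mv_algebra_axioms GX.mv_algebra_axioms h vanishing_prime[OF X x] s(1)]
            s(2) pt[OF x] by simp
        then show ?thesis
          using unit_mvs_hat[OF X x mv_homD(2)[OF h s(1)]] unit_mvs_hat[OF Y f[OF x] s(1)] s hx[OF x] by simp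
      qed
      then show ?thesis
        using x f pt[OF x] by (auto simp: mv_comp_def compose_def fst_unit_mvs Spec_simps intro!: restrict_ext)
    qed
    then show "snd (mvs_comp X (Spec (Gam Y)) ?uY m) = snd (mvs_comp X (Spec (Gam Y)) ?S ?uX)"
      by (auto simp: mvs_comp_simps intro!: restrict_ext)
  qed
qed

section \<open>The equivalence\<close>

theorem theorem5p15:
  shows
    "\<comment> \<open>Spec is a functor from the dual of mv-algebras to mv-spaces\<close>
     (\<forall>A :: 'a mv. mv_algebra A \<longrightarrow> mv_space (Spec A)) \<and>
     (\<forall>(A :: 'a mv) (B :: 'b mv) \<psi>.
        mv_algebra A \<and> mv_algebra B \<and> \<psi> \<in> mv_hom A B \<longrightarrow>
        Spec_map A B \<psi> \<in> mvs_hom (Spec B) (Spec A)) \<and>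
     (\<forall>A :: 'a mv. mv_algebra A \<longrightarrow> Spec_map A A (mv_id A) = mvs_id (Spec A)) \<and>
     (\<forall>(A :: 'a mv) (B :: 'b mv) (C :: 'c mv) \<psi> \<theta>.
        mv_algebra A \<and> mv_algebra B \<and> mv_algebra C \<and> \<psi> \<in> mv_hom A B \<and> \<theta> \<in> mv_hom B C \<longrightarrow>
        Spec_map A C (mv_comp A \<theta> \<psi>) =
          mvs_comp (Spec C) (Spec A) (Spec_map A B \<psi>) (Spec_map B C \<theta>)) \<and>

    \<comment> \<open>Gam is a functor from the dual of mv-spaces to mv-algebras\<close>
     (\<forall>X :: ('x, 'e) mv_sheaf. mv_space X \<longrightarrow> mv_algebra (Gam X)) \<and>
     (\<forall>(X :: ('x, 'e) mv_sheaf) (Y :: ('y, 'f) mv_sheaf) m.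
        mv_space X \<and> mv_space Y \<and> m \<in> mvs_hom X Y \<longrightarrow>
        Gam_map X Y m \<in> mv_hom (Gam Y) (Gam X)) \<and>
     (\<forall>X :: ('x, 'e) mv_sheaf. mv_space X \<longrightarrow> Gam_map X X (mvs_id X) = mv_id (Gam X)) \<and>
     (\<forall>(X :: ('x, 'e) mv_sheaf) (Y :: ('y, 'f) mv_sheaf) (Z :: ('z, 'g) mv_sheaf) m n.
        mv_space X \<and> mv_space Y \<and> mv_space Z \<and> m \<in> mvs_hom X Y \<and> n \<in> mvs_hom Y Z \<longrightarrow>
        Gam_map X Z (mvs_comp X Z n m) = mv_comp (Gam Z) (Gam_map X Y m) (Gam_map Y Z n)) \<and>

    \<comment> \<open>they restrict to the two full subcategories\<close>
     (\<forall>A :: 'a mv. hyperarchimedean A \<longrightarrow> stone_simple_space (Spec A)) \<and>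
     (\<forall>X :: ('x, 'e) mv_sheaf. stone_simple_space X \<longrightarrow> hyperarchimedean (Gam X)) \<and>

    \<comment> \<open>natural isomorphism between the identity and Gam after Spec\<close>
     (\<forall>A :: 'a mv. hyperarchimedean A \<longrightarrow> mv_iso A (Gam (Spec A)) (unit_mv A)) \<and>
     (\<forall>(A :: 'a mv) (B :: 'b mv) \<psi>.
        hyperarchimedean A \<and> hyperarchimedean B \<and> \<psi> \<in> mv_hom A B \<longrightarrow>
        mv_comp A (unit_mv B) \<psi> =
          mv_comp A (Gam_map (Spec B) (Spec A) (Spec_map A B \<psi>)) (unit_mv A)) \<and>

    \<comment> \<open>natural isomorphism between the identity and Spec after Gam\<close>
     (\<forall>X :: ('x, 'e) mv_sheaf. stone_simple_space X \<longrightarrow> mvs_iso X (Spec (Gam X)) (unit_mvs X)) \<and>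
     (\<forall>(X :: ('x, 'e) mv_sheaf) (Y :: ('y, 'f) mv_sheaf) m.
        stone_simple_space X \<and> stone_simple_space Y \<and> m \<in> mvs_hom X Y \<longrightarrow>
        mvs_comp X (Spec (Gam Y)) (unit_mvs Y) m =
          mvs_comp X (Spec (Gam Y)) (Spec_map (Gam Y) (Gam X) (Gam_map X Y m)) (unit_mvs X))"
  by (intro conjI allI impI; (elim conjE)?)
    (rule mv_algebra.Spec_mv_space Spec_map_hom Spec_map_id Spec_map_comp
    Gam_algebra Gam_map_hom Gam_map_id Gam_map_comp
    Spec_stone_simple_space Gam_hyperarchimedean
    unit_mv_iso unit_mv_natural[OF hyperarchimedean_algebra hyperarchimedean_algebra]
    unit_mvs_iso unit_mvs_natural[OF stone_simpleD(1) stone_simpleD(1) stone_simpleD(4)]; assumption)+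

end
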